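(* Assume that the algebras $\mathcal{E}_n$ support a Markov trace with parameters $A$ and $B$, i.e. that for all $n\in\mathbb{N}$ there is a unique linear map $\rho_n:\mathcal{E}_n\to K(A,B)$ satisfying the rules (1)--(4) of the context. Then the Markov trace $\rho_n:\mathcal{E}_n\to K(A,B)$ passes to $\mathrm{PTL}_n$ if and only if $A=-B$ or $A=-B/(1+u)$.
   Context: $K=\mathbb{C}(\sqrt u)$ is the field of rational functions in the variable $\sqrt u$, and $u=(\sqrt u)^2$. All algebras are unital associative $K$-algebras. The algebra of braids and ties $\mathcal{E}_n=\mathcal{E}_n(u)$ is the algebra generated by $1,T_1,\dots,T_{n-1},E_1,\dots,E_{n-1}$ with relations: $T_iT_j=T_jT_i$ for $|i-j|>1$; $T_iT_jT_i=T_jT_iT_j$ for $|i-j|=1$; $T_i^2=1+(u-1)E_i(1+T_i)$ for all $i$; $E_iE_j=E_jE_i$ for all $i,j$; $E_i^2=E_i$ for all $i$; $E_iT_j=T_jE_i$ for $|i-j|>1$; $E_iT_i=T_iE_i$ for all $i$; $E_iE_jT_i=T_iE_iE_j=E_jT_iE_j$ for $|i-j|=1$; $E_iT_jT_i=T_jT_iE_j$ for $|i-j|=1$. Elements of $\mathcal{E}_n$ are regarded as elements of $\mathcal{E}_{n+1}$ by sending generators to the generators of the same name. For $|i-j|=1$ put $T_{ij}=1+T_i+T_j+T_iT_j+T_jT_i+T_iT_jT_i$. The Partition Temperley--Lieb algebra $\mathrm{PTL}_n=\mathrm{PTL}_n(u)$ is defined by adding to the presentation of $\mathcal{E}_n$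 the relations $E_iE_jT_{ij}=0$ for all $|i-j|=1$; so it is a quotient of $\mathcal{E}_n$, and "$\rho_n$ passes to $\mathrm{PTL}_n$" means that $\rho_n$ factors through the canonical surjection $\mathcal{E}_n\to\mathrm{PTL}_n$. Rules of the Markov trace, where $A$ and $B$ are parameters: for all $n$ and all $x,y\in\mathcal{E}_n$, (1) $\rho_n(1)=1$; (2) $\rho_n(xy)=\rho_n(yx)$; (3) $\rho_{n+1}(xT_n)=\rho_{n+1}(xE_nT_n)=A\,\rho_n(x)$; (4) $\rho_{n+1}(xE_n)=B\,\rho_n(x)$. *)

theory Defs
  imports
    "HOL-Library.Poly_Mapping"
    "HOL-Library.FuncSet"
    "HOL-Computational_Algebra.Polynomial"
    "HOL-Computational_Algebra.Fraction_Field"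
    "HOL-Algebra.QuotRing"
    "HOL-Algebra.Module"
begin

text \<open>\<open>K = C(\<surd>u)\<close>; the polynomial variable is \<open>\<surd>u\<close>.\<close>

type_synonym K = "complex poly fract"

definition sqrt_u :: K where
  "sqrt_u = Fract [:0, 1:] 1"

definition u :: K where
  "u = sqrt_u ^ 2"

text \<open>A field extension of \<open>K\<close> is a field type \<open>'l\<close> with a unital ring homomorphism
  \<open>K \<Rightarrow> 'l\<close> (automatically injective).\<close>

definition field_extension :: "(K \<Rightarrow> 'l::field) \<Rightarrow> bool" where
  "field_extension \<phi> \<longleftrightarrow> \<phi> 1 = 1 \<and> (\<forall>x y. \<phi> (x + y) = \<phi> x + \<phi> y \<and> \<phi> (x * y) = \<phi> x * \<phi> y)"

text \<open>\<open>K(A,B)\<close>: the subfield of \<open>'l\<close> generated by \<open>A\<close> and \<open>B\<close> over \<open>K\<close>.\<close>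

inductive_set K_adjoin :: "(K \<Rightarrow> 'l::field) \<Rightarrow> 'l \<Rightarrow> 'l \<Rightarrow> 'l set"
  for \<phi> :: "K \<Rightarrow> 'l" and A B :: 'l where
  scalar: "\<phi> c \<in> K_adjoin \<phi> A B"
| parA: "A \<in> K_adjoin \<phi> A B"
| parB: "B \<in> K_adjoin \<phi> A B"
| diff: "x \<in> K_adjoin \<phi> A B \<Longrightarrow> y \<in> K_adjoin \<phi> A B \<Longrightarrow> x - y \<in> K_adjoin \<phi> A B"
| mult: "x \<in> K_adjoin \<phi> A B \<Longrightarrow> y \<in> K_adjoin \<phi> A B \<Longrightarrow> x * y \<in> K_adjoin \<phi> A B"
| inverse: "x \<in> K_adjoin \<phi> A B \<Longrightarrow> inverse x \<in> K_adjoin \<phi> A B"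


datatype gen = T nat | E nat

fun gen_index :: "gen \<Rightarrow> nat" where
  "gen_index (T i) = i"
| "gen_index (E i) = i"

text \<open>The free monoid on all generators, written additively so that the convolution product of
  \<^theory>\<open>HOL-Library.Poly_Mapping\<close> makes \<open>word \<Rightarrow>\<^sub>0 K\<close> the free associative \<open>K\<close>-algebra.\<close>

datatype word = Word (letters: "gen list")

instantiation word :: monoid_add
begin

definition zero_word :: word where
  "0 = Word []"

definition plus_word :: "word \<Rightarrow> word \<Rightarrow> word" where
  "v + w = Word (letters v @ letters w)"

instance
  by standard (auto simp: zero_word_def plus_word_def)

end

type_synonym free = "word \<Rightarrow>\<^sub>0 K"

definition fgen :: "gen \<Rightarrow> free" where
  "fgen g = Poly_Mapping.single (Word [g]) 1"

definition fscal :: "K \<Rightarrow> free" where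
  "fscal c = Poly_Mapping.single 0 c"

text \<open>The free algebra on \<open>T\<^sub>1, \<dots>, T\<^bsub>n-1\<^esub>, E\<^sub>1, \<dots>, E\<^bsub>n-1\<^esub>\<close>.\<close>

definition free_alg :: "nat \<Rightarrow> free ring" where
  "free_alg n =
    \<lparr>carrier = {f. \<forall>w \<in> Poly_Mapping.keys f. \<forall>g \<in> set (letters w). 1 \<le> gen_index g \<and> gen_index g < n},
     mult = (*), one = 1, zero = 0, add = (+)\<rparr>"

text \<open>\<^const>\<open>genideal\<close> is the generated two-sided ideal. An equation \<open>l = r\<close> of a presentation
  is represented by the element \<open>l - r\<close> of the set \<open>S\<close>.\<close>

definition rel_ideal :: "nat \<Rightarrow> free set \<Rightarrow> free set" where
  "rel_ideal n S = genideal (free_alg n) S"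

definition cls :: "nat \<Rightarrow> free set \<Rightarrow> free \<Rightarrow> free set" where
  "cls n S f = rel_ideal n S +>\<^bsub>free_alg n\<^esub> f"

definition presented :: "nat \<Rightarrow> free set \<Rightarrow> (K, free set) module" where
  "presented n S = (let Q = free_alg n Quot rel_ideal n S in
    \<lparr>carrier = carrier Q, mult = mult Q, one = one Q, zero = zero Q, add = add Q,
     smult = (\<lambda>c X. cls n S (fscal c) \<otimes>\<^bsub>Q\<^esub> X)\<rparr>)"

text \<open>If the relations \<open>S\<close> hold in \<open>presented m S'\<close>, the map sending each coset to the coset of any of its
  representatives is the algebra homomorphism \<open>presented n S \<rightarrow> presented m S'\<close> that sends
  generators to the generators of the same name.\<close>

definition canon :: "nat \<Rightarrow> free set \<Rightarrow> free set \<Rightarrow> free set" where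
  "canon m S' X = (\<Union>f\<in>X. cls m S' f)"


abbreviation Tf :: "nat \<Rightarrow> free" where "Tf i \<equiv> fgen (T i)"
abbreviation Ef :: "nat \<Rightarrow> free" where "Ef i \<equiv> fgen (E i)"

abbreviation adj :: "nat \<Rightarrow> nat \<Rightarrow> bool" where "adj i j \<equiv> \<bar>int i - int j\<bar> = 1"
abbreviation far :: "nat \<Rightarrow> nat \<Rightarrow> bool" where "far i j \<equiv> \<bar>int i - int j\<bar> > 1"

definition BT_rels :: "nat \<Rightarrow> free set" where
  "BT_rels n = (let I = {1..<n} in
      {Tf i * Tf j - Tf j * Tf i | i j. i \<in> I \<and> j \<in> I \<and> far i j}
    \<union> {Tf i * Tf j * Tf i - Tf j * Tf i * Tf j | i j. i \<in> I \<and> j \<in> I \<and> adj i j}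
    \<union> {Tf i ^ 2 - (1 + fscal (u - 1) * Ef i * (1 + Tf i)) | i. i \<in> I}
    \<union> {Ef i * Ef j - Ef j * Ef i | i j. i \<in> I \<and> j \<in> I}
    \<union> {Ef i ^ 2 - Ef i | i. i \<in> I}
    \<union> {Ef i * Tf j - Tf j * Ef i | i j. i \<in> I \<and> j \<in> I \<and> far i j}
    \<union> {Ef i * Tf i - Tf i * Ef i | i. i \<in> I}
    \<union> {Ef i * Ef j * Tf i - Tf i * Ef i * Ef j | i j. i \<in> I \<and> j \<in> I \<and> adj i j}
    \<union> {Tf i * Ef i * Ef j - Ef j * Tf i * Ef j | i j. i \<in> I \<and> j \<in> I \<and> adj i j}
    \<union> {Ef i * Tf j * Tf i - Tf j * Tf i * Ef j | i j. i \<in> I \<and> j \<in> I \<and> adj i j})"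

definition T2f :: "nat \<Rightarrow> nat \<Rightarrow> free" where
  "T2f i j = 1 + Tf i + Tf j + Tf i * Tf j + Tf j * Tf i + Tf i * Tf j * Tf i"

definition PTL_rels :: "nat \<Rightarrow> free set" where
  "PTL_rels n = BT_rels n \<union>
    (let I = {1..<n} in {Ef i * Ef j * T2f i j | i j. i \<in> I \<and> j \<in> I \<and> adj i j})"

definition BT :: "nat \<Rightarrow> (K, free set) module" where
  "BT n = presented n (BT_rels n)"

definition PTL :: "nat \<Rightarrow> (K, free set) module" where
  "PTL n = presented n (PTL_rels n)"

definition BT_T :: "nat \<Rightarrow> nat \<Rightarrow> free set" where
  "BT_T n i = cls n (BT_rels n) (Tf i)"

definition BT_E :: "nat \<Rightarrow> nat \<Rightarrow> free set" where
  "BT_E n i = cls n (BT_rels n) (Ef i)"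

definition BT_incl :: "nat \<Rightarrow> free set \<Rightarrow> free set" where
  "BT_incl n = canon (Suc n) (BT_rels (Suc n))"

definition PTL_proj :: "nat \<Rightarrow> free set \<Rightarrow> free set" where
  "PTL_proj n = canon n (PTL_rels n)"


definition linear_map ::
  "(K \<Rightarrow> 'l::field) \<Rightarrow> (K, 'a) module \<Rightarrow> ('a \<Rightarrow> 'l) \<Rightarrow> bool" where
  "linear_map \<phi> M f \<longleftrightarrow>
    (\<forall>x\<in>carrier M. \<forall>y\<in>carrier M. f (x \<oplus>\<^bsub>M\<^esub> y) = f x + f y) \<and>
    (\<forall>c. \<forall>x\<in>carrier M. f (c \<odot>\<^bsub>M\<^esub> x) = \<phi> c * f x)"

text \<open>Families \<open>(\<rho>\<^sub>n)\<close>, \<open>n \<ge> 1\<close>, of linear maps \<open>BT n \<rightarrow> K(A,B)\<close> satisfying the trace rules. The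
  extensional function spaces make uniqueness meaningful: the values outside the carriers, and
  for \<open>n = 0\<close>, are fixed.\<close>

definition markov_trace ::
  "(K \<Rightarrow> 'l::field) \<Rightarrow> 'l \<Rightarrow> 'l \<Rightarrow> (nat \<Rightarrow> free set \<Rightarrow> 'l) \<Rightarrow> bool" where
  "markov_trace \<phi> A B \<rho> \<longleftrightarrow>
    \<rho> \<in> (\<Pi>\<^sub>E n\<in>{1..}. carrier (BT n) \<rightarrow>\<^sub>E K_adjoin \<phi> A B) \<and>
    (\<forall>n\<ge>1.
      linear_map \<phi> (BT n) (\<rho> n) \<and>
      \<rho> n \<one>\<^bsub>BT n\<^esub> = 1 \<and>
      (\<forall>x\<in>carrier (BT n). \<forall>y\<in>carrier (BT n). \<rho> n (x \<otimes>\<^bsub>BT n\<^esub> y) = \<rho> n (y \<otimes>\<^bsub>BT n\<^esub> x)) \<and>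
      (\<forall>x\<in>carrier (BT n).
        \<rho> (Suc n) (BT_incl n x \<otimes>\<^bsub>BT (Suc n)\<^esub> BT_T (Suc n) n) = A * \<rho> n x \<and>
        \<rho> (Suc n) (BT_incl n x \<otimes>\<^bsub>BT (Suc n)\<^esub> BT_E (Suc n) n \<otimes>\<^bsub>BT (Suc n)\<^esub> BT_T (Suc n) n) = A * \<rho> n x \<and>
        \<rho> (Suc n) (BT_incl n x \<otimes>\<^bsub>BT (Suc n)\<^esub> BT_E (Suc n) n) = B * \<rho> n x))"

definition passes_to_PTL ::
  "(K \<Rightarrow> 'l::field) \<Rightarrow> 'l \<Rightarrow> 'l \<Rightarrow> nat \<Rightarrow> (free set \<Rightarrow> 'l) \<Rightarrow> bool" where
  "passes_to_PTL \<phi> A B n r \<longleftrightarrow>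
    (\<exists>r'. r' \<in> carrier (PTL n) \<rightarrow> K_adjoin \<phi> A B \<and> linear_map \<phi> (PTL n) r' \<and>
      (\<forall>x\<in>carrier (BT n). r' (PTL_proj n x) = r x))"

end

theory Submission
  imports Defs
begin

text \<open>
  A functional on \<open>BT n\<close> factors through \<open>PTL n\<close> iff it vanishes on the two-sided ideal generated by
  \<open>z\<^sub>i\<^sub>j = E\<^sub>i E\<^sub>j T\<^sub>i\<^sub>j\<close>. All these elements are conjugate to \<open>z = z\<^sub>1\<^sub>2\<close>, so for a trace the condition is
  \<open>\<rho>\<^sub>n (x z) = 0\<close> for all \<open>x\<close>. The choice \<open>x = 1\<close> gives \<open>\<rho>\<^sub>n z = (A + B) (B + (1 + u) A)\<close>, hence necessity.
  Conversely, \<open>BT 3\<close> acts on \<open>z\<close> by scalars (\<open>T\<^sub>i z = u z\<close>, \<open>E\<^sub>i z = z\<close>), which settles \<open>x \<in> BT 3\<close>.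
  Every \<open>x \<in> BT (k + 1)\<close> is a sum of terms \<open>a g b\<close> with \<open>a, b \<in> BT k\<close> and
  \<open>g \<in> {1, T\<^sub>k, E\<^sub>k, E\<^sub>k T\<^sub>k}\<close>, and \<open>\<rho>\<^sub>n (a g b z) = \<rho>\<^sub>n (b z a g)\<close> is, by the trace rules, a multiple
  of \<open>\<rho>\<^bsub>n-1\<^esub> (a b z)\<close>, so induction on \<open>k\<close> finishes. The rules only strip \<open>g\<close> with index \<open>n - 1\<close>; smaller
  indices are first raised by conjugation with \<open>T\<^bsub>k+1\<^esub> T\<^sub>k\<close>.
\<close>

section \<open>Identities for two adjacent indices\<close>

text \<open>The roles are \<open>v = u - 1\<close>, \<open>w = 1/u - 1\<close>, \<open>s = T\<^sub>j\<close>, \<open>f = E\<^sub>j\<close>, and below \<open>t = T\<^sub>i\<close>, \<open>e = E\<^sub>i\<close> for an adjacent index \<open>i\<close>.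
  The unit \<open>one\<close> is a parameter because the locale is used in a ring where the image of \<open>1\<close> is only an idempotent.\<close>

locale bt_single =
  fixes one v w s f :: "'r::ring"
  assumes one_l: "x \<in> {one, v, w, s, f} \<Longrightarrow> one * x = x"
    and one_r: "x \<in> {v, w, s, f} \<Longrightarrow> x * one = x"
    and v_c: "x \<in> {w, s, f} \<Longrightarrow> x * v = v * x"
    and w_c: "x \<in> {s, f} \<Longrightarrow> x * w = w * x"
    and vw: "v + w + v * w = 0"
    and quad_raw: "s * s = one + v * f * (one + s)"
    and ff: "f * f = f"
    and fs: "f * s = s * f"
begin

text \<open>The inverse of \<open>s\<close>, obtained by solving the quadratic relation: in
  \<open>s * si\<close> the coefficients of \<open>f\<close> and of \<open>f * s\<close> both
  collapse to \<open>v + w + v * w = 0\<close>.\<close>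

definition "si = s + w * (f + f * s)"

lemmas base = one_l[of one, simplified] one_l[of v, simplified] one_l[of w, simplified]
  one_l[of s, simplified] one_l[of f, simplified]
  one_r[of v, simplified] one_r[of w, simplified] one_r[of s, simplified] one_r[of f, simplified]
  v_c[of w, simplified] v_c[of s, simplified] v_c[of f, simplified]
  w_c[of s, simplified] w_c[of f, simplified] ff

text \<open>After \<open>mult.assoc\<close> products are nested to the right, so a rule for
  \<open>a * b\<close> must also fire when a tail \<open>x\<close> follows.\<close>

lemma assoc_ext: "a * b = c \<Longrightarrow> a * (b * x) = c * (x::'r)"
  by (metis mult.assoc)

lemmas nf = base base[THEN assoc_ext] mult.assoc distrib_left distrib_right

lemma vw0: "w * x + (v * x + v * (w * x)) = 0"
proof -
  have "w * x + (v * x + v * (w * x)) = (v + w + v * w) * x"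
    by (simp add: algebra_simps)
  then show ?thesis by (simp add: vw)
qed

lemma quad: "s * s = one + (v * f + v * f * s)"
  by (simp add: quad_raw nf)

lemma s_si: "s * si = one" and si_s: "si * s = one"
proof -
  have "s * si = one + (w * f + (v * f + v * (w * f))) + (w * (f * s) + (v * (f * s) + v * (w * (f * s))))"
    by (simp add: si_def nf fs[symmetric] fs[symmetric, THEN assoc_ext] quad algebra_simps)
  then show "s * si = one" by (simp add: vw0)
  have "si * s = one + (w * f + (v * f + v * (w * f))) + (w * (f * s) + (v * (f * s) + v * (w * (f * s))))"
    by (simp add: si_def nf fs[symmetric] fs[symmetric, THEN assoc_ext] quad algebra_simps)
  then show "si * s = one" by (simp add: vw0)
qed

end

locale bt_pair = bt_single one v w s f + t: bt_single one v w t e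
  for one v w s f t e :: "'r::ring" +
  assumes braid: "s * t * s = t * s * t"
    and ef: "e * f = f * e"
    and eft: "e * f * t = t * e * f" and fes: "f * e * s = s * f * e"
    and tef: "t * e * f = f * t * f" and sfe: "s * f * e = e * s * e"
    and est: "e * s * t = s * t * f" and fts: "f * t * s = t * s * e"
begin

lemmas et = t.fs and ee = t.ff

lemma f_one: "f * one = f" and t_one: "t * one = t"
  by (simp_all add: base t.base)

text \<open>The relation \<open>fts\<close> multiplied by \<open>si\<close> from the right. It moves
  \<open>t\<close> to the front, where it can meet another \<open>t\<close>.\<close>

lemma f_t: "f * t = t * s * e * si"
proof -
  have "f * t = f * t * s * si" by (simp add: mult.assoc s_si base t.base)
  then show ?thesis by (simp add: fts)
qed

lemma braid': "t * (s * (t * x)) = s * (t * (s * x))"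
  by (metis braid mult.assoc)

lemma comm_ef: "x \<in> {s, t} \<Longrightarrow> x * (e * f) = e * f * x"
  using eft fes ef by (auto simp: mult.assoc)

lemma ese: "e * s * e = e * f * s"
  using sfe fes by (simp add: mult.assoc ef)

text \<open>By \<open>f_t\<close> the two \<open>t\<close> become adjacent and the quadratic
  relation removes their square. The remaining sandwiches \<open>e * s * e\<close> shrink to
  \<open>e * f * s\<close>, whose \<open>s\<close> cancels against \<open>si\<close>.\<close>

lemma sand_tft: "t * f * t = s * e * si + v * (f * e) + v * (f * e * t)"
proof -
  have "t * f * t = t * t * s * e * si"
    by (simp add: mult.assoc f_t)
  also have "\<dots> = s * e * si + v * (e * s * e * si) + v * (t * (e * s * e) * si)"
    by (simp add: t.quad nf et[symmetric] et[symmetric, THEN assoc_ext])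
  also have "e * s * e * si = f * e"
    by (metis ese mult.assoc s_si f_one ef)
  also have "t * (e * s * e) * si = f * e * t"
    by (metis comm_ef ese ef insertCI mult.assoc s_si f_one t_one)
  finally show ?thesis .
qed

text \<open>After \<open>f_t\<close> the braid relation turns \<open>t * s * t * s\<close> into
  \<open>s * t * s * s\<close>, so here the square falls on \<open>s\<close>, the lower index in
  later use.\<close>

lemma sand_tfst: "t * (f * s) * t = s * (t * e) * si + v * (s * (f * e * t)) * si + v * (s * (f * (e * t)))"
proof -
  have fse: "f * s * e = f * e * s"
    using fes fs sfe ese ef by (auto simp: mult.assoc)
  have tfe: "t * f * e = f * e * t"
    using comm_ef[of t] ef by (simp add: mult.assoc)
  then have tfe': "t * (f * (e * x)) = f * (e * (t * x))" for x
    by (metis mult.assoc)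
  have "t * (f * s) * t = t * s * (f * t)"
    by (metis fs mult.assoc)
  also have "\<dots> = t * s * t * s * e * si"
    by (simp add: f_t mult.assoc)
  also have "\<dots> = s * t * (s * s) * e * si"
    by (simp add: braid' mult.assoc)
  also have "\<dots> = s * (t * e) * si + v * (s * (t * f * e)) * si + v * (s * t * (f * s * e)) * si"
    by (simp add: quad nf t.nf)
  also have "\<dots> = s * (t * e) * si + v * (s * (f * e * t)) * si + v * (s * (t * f * e) * (s * si))"
    by (simp only: fse tfe) (simp add: mult.assoc tfe')
  also have "\<dots> = s * (t * e) * si + v * (s * (f * e * t)) * si + v * (s * (f * e * t))"
    by (simp only: tfe s_si) (simp add: nf t.nf)
  finally show ?thesis by (simp add: mult.assoc)
qed

text \<open>Each right-hand side contains the letters of one index only through a single factor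
  \<open>t\<close>, \<open>e\<close> or \<open>e * t\<close> per summand. With
  \<open>sandwiches_e\<close> and the two preceding lemmas this covers every product with a
  nontrivial lower factor between two upper ones.\<close>

lemma sandwiches_t:
  "t * s * t = s * t * s"
  "t * s * e = f * t * s"
  "t * s * (e * t) = f * s * t * s"
  "t * f * e = f * (e * t)"
  "t * f * (e * t) = f * e + v * f * e + v * f * (e * t)"
  "t * (f * s) * e = f * (e * t) * s"
  "t * (f * s) * (e * t) = s * f * (e * t) * s"
proof -
  show "t * s * t = s * t * s" by (simp add: braid)
  show 1: "t * s * e = f * t * s" by (simp add: fts)
  show "t * s * (e * t) = f * s * t * s" by (metis 1 braid mult.assoc)
  show 2: "t * f * e = f * (e * t)"
    using comm_ef[of t] ef by (simp add: mult.assoc)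
  have "t * f * (e * t) = f * e * (t * t)" by (metis 2 mult.assoc)
  also have "\<dots> = f * e + v * f * e + v * f * (e * t)"
    by (simp add: t.quad nf t.nf)
  finally show "t * f * (e * t) = f * e + v * f * e + v * f * (e * t)" .
  have fse: "f * s * e = f * e * s"
    using fes fs sfe ese ef by (auto simp: mult.assoc)
  show 3: "t * (f * s) * e = f * (e * t) * s"
    by (metis fse 2 mult.assoc)
  have "t * (f * s) * (e * t) = f * e * (t * s * t)"
    by (metis 3 mult.assoc)
  also have "\<dots> = s * f * (e * t) * s"
    by (metis braid fes mult.assoc)
  finally show "t * (f * s) * (e * t) = s * f * (e * t) * s" .
qed

lemma sandwiches_e:
  "e * s * t = s * t * f"
  "e * s * e = s * f * e"
  "e * s * (e * t) = s * f * (e * t)"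
  "e * f * t = f * (e * t)"
  "e * f * e = f * e"
  "e * f * (e * t) = f * (e * t)"
  "e * (f * s) * t = s * f * (e * t) "
  "e * (f * s) * e = s * f * e"
  "e * (f * s) * (e * t) = s * f * (e * t)"
proof -
  show "e * s * t = s * t * f" by (rule est)
  show 1: "e * s * e = s * f * e" by (rule sfe[symmetric])
  then show "e * s * (e * t) = s * f * (e * t)" by (metis mult.assoc)
  show "e * f * t = f * (e * t)" using ef by (simp add: mult.assoc)
  show 2: "e * f * e = f * e" using ef by (metis ee mult.assoc)
  then show "e * f * (e * t) = f * (e * t)" by (metis mult.assoc)
  show "e * (f * s) * t = s * f * (e * t)" using ef fes by (metis mult.assoc)
  have fse: "f * s * e = s * f * e"
    using fes fs sfe ese ef by (auto simp: mult.assoc)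
  show 3: "e * (f * s) * e = s * f * e"
    by (metis fse mult.assoc 1 fs ef fes ee)
  then show "e * (f * s) * (e * t) = s * f * (e * t)" by (metis mult.assoc)
qed

text \<open>The bracket is the sum over the six elements of the symmetric group on three letters,
  that is, the Hecke algebra symmetrizer; \<open>e * f\<close> is the idempotent on which the Hecke
  relation holds.\<close>

definition "sym_elem = e * f * (one + t + s + t * s + s * t + t * s * t)"

text \<open>Next to \<open>e * f\<close> the quadratic relation reads
  \<open>t * t = u + (u - 1) * t\<close>. The six terms split into pairs \<open>y\<close>,
  \<open>t * y\<close>, and \<open>t\<close> multiplies the sum of each pair by \<open>u\<close>,
  here written \<open>one + v\<close>.\<close>

lemma t_sym_elem: "t * sym_elem = one * sym_elem + v * sym_elem"
proof -
  have "t * (e * (f * x)) = e * (f * (t * x))" "e * (f * (e * x)) = e * (f * x)"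
    "t * (e * f) = e * (f * t)" "e * (f * e) = e * f" for x
    using comm_ef[of t] ef ee by (metis insert_iff mult.assoc)+
  note rules = this
  show ?thesis
    unfolding sym_elem_def by (simp add: nf t.nf t.quad t.quad[THEN assoc_ext] rules algebra_simps)
qed

lemma e_sym_elem: "e * sym_elem = sym_elem"
  unfolding sym_elem_def by (simp add: nf t.nf)

lemma sym_elem_swap: "f * e * (one + s + t + s * t + t * s + s * t * s) = sym_elem"
  unfolding sym_elem_def by (simp add: braid ef add.commute add.left_commute)

end

section \<open>Presented algebras\<close>

abbreviation F :: "nat \<Rightarrow> free set" where "F n \<equiv> carrier (free_alg n)"

definition word_in :: "nat \<Rightarrow> word \<Rightarrow> bool" where
  "word_in n w \<longleftrightarrow> (\<forall>g\<in>set (letters w). 1 \<le> gen_index g \<and> gen_index g < n)"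

lemma word_in_zero [simp]: "word_in n 0"
  by (simp add: word_in_def zero_word_def)

lemma word_in_add [simp]: "word_in n (v + w) \<longleftrightarrow> word_in n v \<and> word_in n w"
  by (auto simp: word_in_def plus_word_def)

lemma word_in_single [simp]: "word_in n (Word [g]) \<longleftrightarrow> 1 \<le> gen_index g \<and> gen_index g < n"
  by (simp add: word_in_def)

lemma word_in_mono: "word_in m w \<Longrightarrow> m \<le> n \<Longrightarrow> word_in n w"
  by (fastforce simp: word_in_def)

lemma F_eq: "F n = {f. \<forall>w\<in>Poly_Mapping.keys f. word_in n w}"
  by (simp add: free_alg_def word_in_def)

lemma free_alg_sel [simp]:
  "mult (free_alg n) = (*)" "one (free_alg n) = 1" "zero (free_alg n) = 0" "add (free_alg n) = (+)"
  by (simp_all add: free_alg_def)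

lemma single_in_F [simp]: "word_in n w \<Longrightarrow> Poly_Mapping.single w c \<in> F n"
  by (simp add: F_eq)

lemma F_zero [simp]: "0 \<in> F n"
  by (simp add: F_eq)

lemma F_add [simp]: "f \<in> F n \<Longrightarrow> g \<in> F n \<Longrightarrow> f + g \<in> F n"
  unfolding F_eq using keys_add[of f g] by blast

lemma F_uminus [simp]: "f \<in> F n \<Longrightarrow> - f \<in> F n"
  by (simp add: F_eq)

lemma F_diff [simp]: "f \<in> F n \<Longrightarrow> g \<in> F n \<Longrightarrow> f - g \<in> F n"
  using F_add[of f n "- g"] by simp

lemma F_mult [simp]:
  assumes "f \<in> F n" "g \<in> F n" shows "f * g \<in> F n"
proof -
  have "word_in n w" if "w \<in> Poly_Mapping.keys (f * g)" for w
    using that keys_mult[of f g] assms by (auto simp: F_eq)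
  then show ?thesis by (simp add: F_eq)
qed

lemma F_fscal [simp]: "fscal c \<in> F n"
  by (simp add: fscal_def)

lemma fscal_1: "fscal 1 = 1"
  by (simp add: fscal_def)

lemma F_one [simp]: "1 \<in> F n"
  using F_fscal[of 1 n] by (simp add: fscal_1)

lemma F_power [simp]: "f \<in> F n \<Longrightarrow> f ^ k \<in> F n"
  by (induction k) simp_all

lemma F_Tf [simp]: "1 \<le> i \<Longrightarrow> i < n \<Longrightarrow> Tf i \<in> F n"
  and F_Ef [simp]: "1 \<le> i \<Longrightarrow> i < n \<Longrightarrow> Ef i \<in> F n"
  by (simp_all add: fgen_def)

lemma F_mono: "f \<in> F m \<Longrightarrow> m \<le> n \<Longrightarrow> f \<in> F n"
  by (auto simp: F_eq intro: word_in_mono)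

lemma free_induct [case_names zero add]:
  assumes "P 0" and step: "\<And>w c f. P f \<Longrightarrow> P (Poly_Mapping.single w c + f)"
  shows "P (f :: free)"
proof (induction f rule: update_induct)
  case const then show ?case by (fact assms)
next
  case (update f a b)
  have "Poly_Mapping.update a b f = Poly_Mapping.single a b + f"
    using update(1)
    by (intro poly_mapping_eqI)
      (auto simp: lookup_update lookup_add lookup_single in_keys_iff when_def)
  then show ?case using step[OF update(3)] by simp
qed

text \<open>Drops all words with an index outside the range of \<open>n\<close>. A concatenation is
  admissible iff both parts are, so this projection onto \<open>F n\<close> is
  multiplicative.\<close>

lift_definition restr :: "nat \<Rightarrow> (word \<Rightarrow>\<^sub>0 'a::zero) \<Rightarrow> word \<Rightarrow>\<^sub>0 'a" is "\<lambda>n f w. if word_in n w then f w else 0"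
  by (rule rev_finite_subset) auto

lemma lookup_restr: "Poly_Mapping.lookup (restr n f) w = (if word_in n w then Poly_Mapping.lookup f w else 0)"
  by transfer simp

lemma restr_in_F [simp]: "restr n f \<in> F n"
  by (auto simp: F_eq in_keys_iff lookup_restr split: if_splits)

lemma restr_id [simp]: "f \<in> F n \<Longrightarrow> restr n f = f"
  by (rule poly_mapping_eqI) (auto simp: lookup_restr F_eq in_keys_iff)

lemma restr_add: "restr n (f + g) = restr n f + restr n g"
  by (rule poly_mapping_eqI) (auto simp: lookup_restr lookup_add)

lemma restr_single: "restr n (Poly_Mapping.single w c) = (if word_in n w then Poly_Mapping.single w c else 0)"
  by (rule poly_mapping_eqI) (auto simp: lookup_restr lookup_single when_def)

lemma restr_zero [simp]: "restr n 0 = 0"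
  by (rule poly_mapping_eqI) (simp add: lookup_restr)

lemma restr_single_mult: "restr n (Poly_Mapping.single w c * g) = restr n (Poly_Mapping.single w c) * restr n g"
  for g :: free
  by (induction g rule: free_induct) (auto simp: distrib_left restr_add restr_single mult_single)

lemma restr_mult: "restr n (f * g) = restr n f * restr n g"
  for f g :: free
  by (induction f rule: free_induct) (auto simp: distrib_right restr_add restr_single_mult)

lemma fscal_add: "fscal (a + b) = fscal a + fscal b"
  by (simp add: fscal_def single_add)

lemma fscal_mult: "fscal (a * b) = fscal a * fscal b"
  by (simp add: fscal_def mult_single)

lemma fscal_central: "f * fscal c = fscal c * f"
  by (induction f rule: free_induct) (auto simp: fscal_def algebra_simps mult_single)

lemma single_Word_Cons:
  "Poly_Mapping.single (Word (g # gs)) c = fgen g * Poly_Mapping.single (Word gs) c"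
  by (simp add: fgen_def mult_single plus_word_def)

lemma F_induct [consumes 1, case_names scal add gen]:
  assumes "f \<in> F n"
    and scal: "\<And>c. P (fscal c)"
    and add: "\<And>f g. f \<in> F n \<Longrightarrow> g \<in> F n \<Longrightarrow> P f \<Longrightarrow> P g \<Longrightarrow> P (f + g)"
    and gen: "\<And>x f. f \<in> F n \<Longrightarrow> P f \<Longrightarrow> 1 \<le> gen_index x \<Longrightarrow> gen_index x < n \<Longrightarrow> P (fgen x * f)"
  shows "P f"
proof -
  have word: "word_in n (Word gs) \<Longrightarrow> P (Poly_Mapping.single (Word gs) c)" for gs c
  proof (induction gs)
    case Nil
    then show ?case using scal[of c] by (simp add: fscal_def zero_word_def)
  next
    case (Cons g gs)
    then show ?case by (auto simp: single_Word_Cons word_in_def intro!: gen)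
  qed
  \<comment> \<open>Induction over all of \<open>free\<close> passes through arbitrary words;
    projecting to \<open>F n\<close> discards those about which nothing is known.\<close>
  have "P (restr n f)"
  proof (induction f rule: free_induct)
    case zero
    then show ?case using scal[of 0] by (simp add: fscal_def)
  next
    case (add w c f)
    show ?case
    proof (cases "word_in n w")
      case True
      then show ?thesis using word[of "letters w" c] add
        by (auto simp: restr_add restr_single intro!: assms(3))
    qed (use add in \<open>simp add: restr_add restr_single\<close>)
  qed
  with assms(1) show ?thesis by simp
qed

lemma ring_free_alg: "ring (free_alg n)"
proof (rule ringI)
  show "abelian_group (free_alg n)"
    by (rule abelian_groupI) (auto simp: add.assoc add.commute intro: exI[of _ "- x" for x] bexI[of _ "- x" for x])
  show "Group.monoid (free_alg n)"
    by (rule Group.monoidI) (auto simp: mult.assoc)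
qed (auto simp: distrib_left distrib_right)

section \<open>Generated ideals and their cosets\<close>

lemma BT_rels_subset: "BT_rels n \<subseteq> F n"
  by (auto simp: BT_rels_def Let_def)

lemma PTL_rels_subset: "PTL_rels n \<subseteq> F n"
  using BT_rels_subset[of n] by (auto simp: PTL_rels_def T2f_def Let_def)

lemma rel_ideal_ideal: "S \<subseteq> F n \<Longrightarrow> ideal (rel_ideal n S) (free_alg n)"
  by (simp add: rel_ideal_def ring.genideal_ideal[OF ring_free_alg])

lemma rel_ideal_self: "S \<subseteq> F n \<Longrightarrow> S \<subseteq> rel_ideal n S"
  by (simp add: rel_ideal_def ring.genideal_self[OF ring_free_alg])

lemma rel_idealI:
  assumes "S \<subseteq> I" "I \<subseteq> F n" "0 \<in> I" "\<And>f g. f \<in> I \<Longrightarrow> g \<in> I \<Longrightarrow> f + g \<in> I"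
    "\<And>f x. f \<in> I \<Longrightarrow> x \<in> F n \<Longrightarrow> x * f \<in> I" "\<And>f x. f \<in> I \<Longrightarrow> x \<in> F n \<Longrightarrow> f * x \<in> I"
  shows "rel_ideal n S \<subseteq> I"
proof -
  have "ideal I (free_alg n)"
  proof (rule idealI)
    show "subgroup I (add_monoid (free_alg n))"
    proof (rule group.subgroupI)
      show "Group.group (add_monoid (free_alg n))"
        by (rule abelian_group.a_group[OF ring.is_abelian_group[OF ring_free_alg]])
      fix a assume a: "a \<in> I"
      then have "a \<in> F n" using assms by blast
      interpret ring "free_alg n" by (rule ring_free_alg)
      have "\<ominus>\<^bsub>free_alg n\<^esub> a = - a"
        using \<open>a \<in> F n\<close> by (intro minus_equality) auto
      \<comment> \<open>Negation is multiplication by -1, so it is covered by closure under left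
        multiplication.\<close>
      moreover have "- a \<in> I" using assms(5)[OF a F_uminus[OF F_one]] by simp
      ultimately show "inv\<^bsub>add_monoid (free_alg n)\<^esub> a \<in> I"
        by (simp add: a_inv_def)
    qed (use assms in auto)
  qed (use assms ring_free_alg in auto)
  then show ?thesis
    using assms(1) by (simp add: rel_ideal_def ring.genideal_minimal[OF ring_free_alg])
qed

lemma presented_sel:
  "carrier (presented n S) = cls n S ` F n"
  "\<zero>\<^bsub>presented n S\<^esub> = rel_ideal n S"
  "\<one>\<^bsub>presented n S\<^esub> = cls n S 1"
  by (auto simp: presented_def Let_def cls_def FactRing_def A_RCOSETS_def')

lemma presented_ops:
  assumes "S \<subseteq> F n" "f \<in> F n" "g \<in> F n"
  shows "cls n S f \<otimes>\<^bsub>presented n S\<^esub> cls n S g = cls n S (f * g)"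
    and "cls n S f \<oplus>\<^bsub>presented n S\<^esub> cls n S g = cls n S (f + g)"
    and "c \<odot>\<^bsub>presented n S\<^esub> cls n S g = cls n S (fscal c * g)"
proof -
  interpret ideal "rel_ideal n S" "free_alg n" by (rule rel_ideal_ideal[OF assms(1)])
  note * = ring_hom_mult[OF rcos_ring_hom] ring_hom_add[OF rcos_ring_hom]
  show "cls n S f \<otimes>\<^bsub>presented n S\<^esub> cls n S g = cls n S (f * g)"
    and "cls n S f \<oplus>\<^bsub>presented n S\<^esub> cls n S g = cls n S (f + g)"
    and "c \<odot>\<^bsub>presented n S\<^esub> cls n S g = cls n S (fscal c * g)"
    using assms(2,3) by (simp_all add: presented_def Let_def cls_def * [symmetric])
qed

lemma rel_ideal_closed:
  assumes "S \<subseteq> F n"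
  shows "0 \<in> rel_ideal n S"
    and "f \<in> rel_ideal n S \<Longrightarrow> g \<in> rel_ideal n S \<Longrightarrow> f + g \<in> rel_ideal n S"
    and "f \<in> rel_ideal n S \<Longrightarrow> x \<in> F n \<Longrightarrow> x * f \<in> rel_ideal n S"
    and "f \<in> rel_ideal n S \<Longrightarrow> x \<in> F n \<Longrightarrow> f * x \<in> rel_ideal n S"
proof -
  interpret ideal "rel_ideal n S" "free_alg n" by (rule rel_ideal_ideal[OF assms])
  show "0 \<in> rel_ideal n S"
    using additive_subgroup.zero_closed[OF is_additive_subgroup] by simp
  show "f \<in> rel_ideal n S \<Longrightarrow> g \<in> rel_ideal n S \<Longrightarrow> f + g \<in> rel_ideal n S"
    using additive_subgroup.a_closed[OF is_additive_subgroup, of f g] by simp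
  show "f \<in> rel_ideal n S \<Longrightarrow> x \<in> F n \<Longrightarrow> x * f \<in> rel_ideal n S"
    and "f \<in> rel_ideal n S \<Longrightarrow> x \<in> F n \<Longrightarrow> f * x \<in> rel_ideal n S"
    using I_l_closed[of f x] I_r_closed[of f x] by simp_all
qed

lemma cls_mem_iff:
  assumes "S \<subseteq> F n" "f \<in> F n"
  shows "g \<in> cls n S f \<longleftrightarrow> g \<in> F n \<and> g - f \<in> rel_ideal n S"
proof -
  interpret ideal "rel_ideal n S" "free_alg n" by (rule rel_ideal_ideal[OF assms(1)])
  have "g \<in> cls n S f \<longleftrightarrow> (\<exists>h\<in>rel_ideal n S. g = h + f)"
    by (auto simp: cls_def a_r_coset_def')
  also have "\<dots> \<longleftrightarrow> g - f \<in> rel_ideal n S"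
    by (auto intro: bexI[of _ "g - f"])
  finally show ?thesis
    using F_add[OF subsetD[OF a_subset, of "g - f"] assms(2)] by auto
qed

lemma cls_self: "S \<subseteq> F n \<Longrightarrow> f \<in> F n \<Longrightarrow> f \<in> cls n S f"
  by (simp add: cls_mem_iff rel_ideal_closed)

lemma cls_eq_iff:
  assumes "S \<subseteq> F n" "f \<in> F n" "g \<in> F n"
  shows "cls n S f = cls n S g \<longleftrightarrow> f - g \<in> rel_ideal n S"
proof
  show "cls n S f = cls n S g \<Longrightarrow> f - g \<in> rel_ideal n S"
    using cls_self[OF assms(1,2)] cls_mem_iff[OF assms(1,3)] by auto
next
  interpret ideal "rel_ideal n S" "free_alg n" by (rule rel_ideal_ideal[OF assms(1)])
  assume fg: "f - g \<in> rel_ideal n S"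
  then have "f \<in> cls n S g" using assms by (simp add: cls_mem_iff)
  then show "cls n S f = cls n S g"
    using a_repr_independence[OF _ _ a_subgroup, of f g] assms(3) by (simp add: cls_def)
qed

lemma rel_ideal_mono:
  assumes "S \<subseteq> S'" "S' \<subseteq> F m" "n \<le> m"
  shows "rel_ideal n (S \<inter> F n) \<subseteq> rel_ideal m S'"
proof -
  have F: "f \<in> F m" if "f \<in> F n" for f
    using that assms(3) by (rule F_mono)
  \<comment> \<open>The trace of the larger ideal on \<open>F n\<close> is itself an ideal of the
    smaller algebra, so minimality applies.\<close>
  have "rel_ideal n (S \<inter> F n) \<subseteq> rel_ideal m S' \<inter> F n"
  proof (rule rel_idealI)
    show "S \<inter> F n \<subseteq> rel_ideal m S' \<inter> F n"
      using assms rel_ideal_self[OF assms(2)] by blast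
  qed (use rel_ideal_closed[OF assms(2)] F in auto)
  then show ?thesis by blast
qed

text \<open>All representatives of a coset have the same class modulo the larger ideal, so the union
  defining \<open>canon\<close> is a union of equal sets over a nonempty coset.\<close>

lemma canon_cls:
  assumes "S \<subseteq> F n" "S \<subseteq> S'" "S' \<subseteq> F m" "n \<le> m" "f \<in> F n"
  shows "canon m S' (cls n S f) = cls m S' f"
proof -
  have "cls m S' g = cls m S' f" if "g \<in> cls n S f" for g
  proof -
    have "g \<in> F n" "g - f \<in> rel_ideal n S" using that assms by (simp_all add: cls_mem_iff)
    moreover have "rel_ideal n S \<subseteq> rel_ideal m S'"
      using rel_ideal_mono[OF assms(2-4)] assms(1) by (simp add: Int_absorb2)
    ultimately show ?thesis
      using cls_eq_iff[OF assms(3) F_mono[OF _ assms(4)] F_mono[OF assms(5,4)]] by blast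
  qed
  then have "canon m S' (cls n S f) = (\<Union>g\<in>cls n S f. cls m S' f)"
    unfolding canon_def by (rule SUP_cong[OF refl])
  also have "\<dots> = cls m S' f"
    using cls_self[OF assms(1,5)] by blast
  finally show ?thesis .
qed

lemma BT_rels_mono:
  assumes "n \<le> m" shows "BT_rels n \<subseteq> BT_rels m"
proof -
  have sub: "{1..<n} \<subseteq> {1..<m}" using assms by auto
  have 1: "{f i |i. i \<in> {1..<n}} \<subseteq> {f i |i. i \<in> {1..<m}}" for f :: "nat \<Rightarrow> free"
    using sub by blast
  have 2: "{f i j |i j. i \<in> {1..<n} \<and> j \<in> {1..<n}} \<subseteq> {f i j |i j. i \<in> {1..<m} \<and> j \<in> {1..<m}}"
    for f :: "nat \<Rightarrow> nat \<Rightarrow> free"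
    using sub by blast
  have 3: "{f i j |i j. i \<in> {1..<n} \<and> j \<in> {1..<n} \<and> P i j}
    \<subseteq> {f i j |i j. i \<in> {1..<m} \<and> j \<in> {1..<m} \<and> P i j}"
    for f :: "nat \<Rightarrow> nat \<Rightarrow> free" and P
    using sub by blast
  show ?thesis
    unfolding BT_rels_def Let_def by (intro Un_mono; (rule 3 | rule 2 | rule 1))
qed

section \<open>The algebras of braids and ties as components of one ring\<close>

text \<open>Composing with \<open>restr\<close> makes the class map total on \<open>free\<close>, so
  that it respects the operations without any membership conditions.\<close>

definition bt_cls :: "nat \<Rightarrow> free \<Rightarrow> free set" where
  "bt_cls n f = cls n (BT_rels n) (restr n f)"

lemma bt_cls_in [simp]: "bt_cls n f \<in> carrier (BT n)"
  by (simp add: bt_cls_def BT_def presented_sel)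

lemma bt_cls_mult: "bt_cls n (f * g) = bt_cls n f \<otimes>\<^bsub>BT n\<^esub> bt_cls n g"
  and bt_cls_add: "bt_cls n (f + g) = bt_cls n f \<oplus>\<^bsub>BT n\<^esub> bt_cls n g"
  and bt_cls_scal: "bt_cls n (fscal c * g) = c \<odot>\<^bsub>BT n\<^esub> bt_cls n g"
  by (simp_all add: bt_cls_def BT_def presented_ops[OF BT_rels_subset F_zero restr_in_F]
      presented_ops[OF BT_rels_subset] restr_mult restr_add)

lemma bt_cls_uminus_cong:
  assumes "bt_cls n f = bt_cls n g" shows "bt_cls n (- f) = bt_cls n (- g)"
  using assms bt_cls_mult[of n "- 1" f] bt_cls_mult[of n "- 1" g] by simp

lemma bt_cls_eqI: "f - g \<in> BT_rels n \<Longrightarrow> f \<in> F n \<Longrightarrow> g \<in> F n \<Longrightarrow> bt_cls n f = bt_cls n g"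
  using rel_ideal_self[OF BT_rels_subset] by (auto simp: bt_cls_def cls_eq_iff[OF BT_rels_subset])

text \<open>The product of all \<open>BT n\<close>. A single type containing every \<open>BT n\<close> as a factor turns congruences modulo the
  relations into equations of a type-class ring, although \<open>n\<close> is a variable.\<close>

quotient_type bt = "nat \<Rightarrow> free" / "\<lambda>f g. \<forall>n. bt_cls n (f n) = bt_cls n (g n)"
  by (intro equivpI reflpI sympI transpI) auto

lemma bt_cls_rep_abs [simp]: "bt_cls n (rep_bt (abs_bt f) n) = bt_cls n (f n)"
  using Quotient3_abs_rep[OF Quotient3_bt, of "abs_bt f"] by (simp add: bt.abs_eq_iff)

instantiation bt :: ring
begin

definition zero_bt :: bt where "0 = abs_bt (\<lambda>_. 0)"
definition plus_bt :: "bt \<Rightarrow> bt \<Rightarrow> bt" where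
  "x + y = abs_bt (\<lambda>n. rep_bt x n + rep_bt y n)"
definition times_bt :: "bt \<Rightarrow> bt \<Rightarrow> bt" where
  "x * y = abs_bt (\<lambda>n. rep_bt x n * rep_bt y n)"
definition uminus_bt :: "bt \<Rightarrow> bt" where
  "- x = abs_bt (\<lambda>n. - rep_bt x n)"
definition minus_bt :: "bt \<Rightarrow> bt \<Rightarrow> bt" where
  "x - y = x + - (y :: bt)"

lemma bt_abs_ops:
  "abs_bt f + abs_bt g = abs_bt (\<lambda>n. f n + g n)"
  "abs_bt f * abs_bt g = abs_bt (\<lambda>n. f n * g n)"
  "- abs_bt f = abs_bt (\<lambda>n. - f n)"
  by (simp_all add: plus_bt_def times_bt_def uminus_bt_def bt.abs_eq_iff bt_cls_add bt_cls_mult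
      bt_cls_uminus_cong[OF bt_cls_rep_abs])

instance
proof
  fix a b c :: bt
  obtain f g h where [simp]: "a = abs_bt f" "b = abs_bt g" "c = abs_bt h"
    using Quotient3_abs_rep[OF Quotient3_bt] by metis
  show "a + b + c = a + (b + c)" by (simp add: bt_abs_ops add.assoc)
  show "a + b = b + a" by (simp add: bt_abs_ops add.commute)
  show "0 + a = a" by (simp add: bt_abs_ops zero_bt_def)
  show "- a + a = 0" by (simp add: bt_abs_ops zero_bt_def)
  show "a - b = a + - b" by (rule minus_bt_def)
  show "a * b * c = a * (b * c)" by (simp add: bt_abs_ops mult.assoc)
  show "(a + b) * c = a * c + b * c" by (simp add: bt_abs_ops distrib_right)
  show "a * (b + c) = a * b + a * c" by (simp add: bt_abs_ops distrib_left)
qed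

end

text \<open>Inclusion of the factor \<open>BT m\<close> into the product. It is additive and
  multiplicative but sends 1 to an idempotent only, and by \<open>img_eq_iff\<close> equality of
  images is equality in \<open>BT m\<close>.\<close>

definition bt_img :: "nat \<Rightarrow> free \<Rightarrow> bt" where
  "bt_img m f = abs_bt (\<lambda>n. if n = m then f else 0)"

lemma img_eq_iff: "bt_img m f = bt_img m g \<longleftrightarrow> bt_cls m f = bt_cls m g"
  by (auto simp: bt_img_def bt.abs_eq_iff)

lemma img_zero [simp]: "bt_img m 0 = 0"
  by (simp add: bt_img_def zero_bt_def)
lemma img_add: "bt_img m (f + g) = bt_img m f + bt_img m g"
  by (auto simp: bt_img_def bt_abs_ops bt.abs_eq_iff)
lemma img_mult: "bt_img m (f * g) = bt_img m f * bt_img m g"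
  by (auto simp: bt_img_def bt_abs_ops bt.abs_eq_iff)
lemma img_one: "bt_img m 1 * bt_img m f = bt_img m f" "bt_img m f * bt_img m 1 = bt_img m f"
  by (simp_all flip: img_mult)

section \<open>The defining relations as equations in the product ring\<close>

lemma img_eqI: "f - g \<in> BT_rels n \<Longrightarrow> f \<in> F n \<Longrightarrow> g \<in> F n \<Longrightarrow> bt_img n f = bt_img n g"
  by (simp add: img_eq_iff bt_cls_eqI)

lemma BT_rels_mem:
  assumes "i \<in> {1..<n}"
  shows "Tf i ^ 2 - (1 + fscal (u - 1) * Ef i * (1 + Tf i)) \<in> BT_rels n"
    and "Ef i ^ 2 - Ef i \<in> BT_rels n"
    and "Ef i * Tf i - Tf i * Ef i \<in> BT_rels n"
    and "j \<in> {1..<n} \<Longrightarrow> Ef i * Ef j - Ef j * Ef i \<in> BT_rels n"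
    and "j \<in> {1..<n} \<Longrightarrow> far i j \<Longrightarrow> Tf i * Tf j - Tf j * Tf i \<in> BT_rels n"
    and "j \<in> {1..<n} \<Longrightarrow> far i j \<Longrightarrow> Ef i * Tf j - Tf j * Ef i \<in> BT_rels n"
    and "j \<in> {1..<n} \<Longrightarrow> adj i j \<Longrightarrow> Tf i * Tf j * Tf i - Tf j * Tf i * Tf j \<in> BT_rels n"
    and "j \<in> {1..<n} \<Longrightarrow> adj i j \<Longrightarrow> Ef i * Ef j * Tf i - Tf i * Ef i * Ef j \<in> BT_rels n"
    and "j \<in> {1..<n} \<Longrightarrow> adj i j \<Longrightarrow> Tf i * Ef i * Ef j - Ef j * Tf i * Ef j \<in> BT_rels n"
    and "j \<in> {1..<n} \<Longrightarrow> adj i j \<Longrightarrow> Ef i * Tf j * Tf i - Tf j * Tf i * Ef j \<in> BT_rels n"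
  using assms unfolding BT_rels_def Let_def by blast+

abbreviation (input) vv :: free where "vv \<equiv> fscal (u - 1)"
abbreviation (input) ww :: free where "ww \<equiv> fscal (inverse u - 1)"

lemma u_nonzero: "u \<noteq> 0" "1 + u \<noteq> 0"
proof -
  have u: "u = Fract [:0, 0, 1:] 1"
    by (simp add: u_def sqrt_u_def power2_eq_square)
  show "u \<noteq> 0" by (simp add: u Zero_fract_def eq_fract)
  have "1 + u = Fract [:1, 0, 1:] 1"
    by (simp add: u One_fract_def one_pCons)
  then show "1 + u \<noteq> 0" by (simp add: Zero_fract_def eq_fract)
qed

context
  fixes m i :: nat
  assumes i: "1 \<le> i" "i < m"
begin

lemma img_quad: "bt_img m (Tf i * Tf i) = bt_img m (1 + vv * Ef i * (1 + Tf i))"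
  and img_EE: "bt_img m (Ef i * Ef i) = bt_img m (Ef i)"
  and img_ET: "bt_img m (Ef i * Tf i) = bt_img m (Tf i * Ef i)"
  using i BT_rels_mem[of i m] by (simp_all add: img_eqI power2_eq_square)

context
  fixes j :: nat
  assumes j: "1 \<le> j" "j < m"
begin

lemma img_Ec: "bt_img m (Ef i * Ef j) = bt_img m (Ef j * Ef i)"
  using i j BT_rels_mem(4)[of i m j] by (simp add: img_eqI)

lemma img_far:
  assumes "far i j"
  shows "bt_img m (Tf i * Tf j) = bt_img m (Tf j * Tf i)" "bt_img m (Ef i * Tf j) = bt_img m (Tf j * Ef i)"
  by (rule img_eqI; use i j assms BT_rels_mem(5,6)[of i m j] in simp)+

lemma img_adj:
  assumes "adj i j"
  shows "bt_img m (Tf i * Tf j * Tf i) = bt_img m (Tf j * Tf i * Tf j)"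
    "bt_img m (Ef i * Ef j * Tf i) = bt_img m (Tf i * Ef i * Ef j)"
    "bt_img m (Tf i * Ef i * Ef j) = bt_img m (Ef j * Tf i * Ef j)"
    "bt_img m (Ef i * Tf j * Tf i) = bt_img m (Tf j * Tf i * Ef j)"
  by (rule img_eqI; use i j assms BT_rels_mem(7-10)[of i m j] in simp)+

end

end

lemma bt_single_img:
  assumes i: "1 \<le> i" "i < m"
  shows "bt_single (bt_img m 1) (bt_img m vv) (bt_img m ww) (bt_img m (Tf i)) (bt_img m (Ef i))"
proof -
  note fold = img_mult[symmetric] img_add[symmetric]
  have "vv + ww + vv * ww = 0"
    using u_nonzero(1) by (simp add: fscal_def single_add[symmetric] mult_single algebra_simps)
  then have vw: "bt_img m vv + bt_img m ww + bt_img m vv * bt_img m ww = 0"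
    unfolding fold by (simp add: add.assoc)
  have central: "bt_img m f * bt_img m (fscal c) = bt_img m (fscal c) * bt_img m f" for f c
    by (simp only: fold fscal_central)
  show ?thesis
    by (unfold_locales; (elim insertE emptyE; hypsubst; rule central img_one)?; (rule vw)?; (unfold fold)?;
        (rule img_quad[OF i] img_EE[OF i] img_ET[OF i])?)
qed

lemma bt_pair_img:
  assumes i: "1 \<le> i" "i < m" and j: "1 \<le> j" "j < m" and "adj i j"
  shows "bt_pair (bt_img m 1) (bt_img m vv) (bt_img m ww) (bt_img m (Tf j)) (bt_img m (Ef j)) (bt_img m (Tf i)) (bt_img m (Ef i))"
proof -
  have "adj j i" using \<open>adj i j\<close> by linarith
  note ij = img_adj[OF i j \<open>adj i j\<close>] and ji = img_adj[OF j i \<open>adj j i\<close>]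
  show ?thesis
    by (intro bt_pair.intro bt_single_img bt_pair_axioms.intro i j; unfold img_mult[symmetric];
        rule img_Ec[OF i j] ij(2-4) ji)
qed

section \<open>Spanning elements\<close>

text \<open>The lift of \<open>si\<close> to the free algebra: an inverse of \<open>Tf j\<close>
  modulo the relations.\<close>

definition Tinv :: "nat \<Rightarrow> free" where
  "Tinv j = Tf j + ww * (Ef j + Ef j * Tf j)"

lemma Tinv_in_F [simp]: "1 \<le> j \<Longrightarrow> j < m \<Longrightarrow> Tinv j \<in> F m"
  by (simp add: Tinv_def)

lemma img_Tinv:
  assumes "1 \<le> j" "j < m"
  shows "bt_img m (Tf j * Tinv j) = bt_img m 1" "bt_img m (Tinv j * Tf j) = bt_img m 1"
proof -
  interpret bt_single "bt_img m 1" "bt_img m vv" "bt_img m ww" "bt_img m (Tf j)" "bt_img m (Ef j)"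
    by (rule bt_single_img[OF assms])
  have "bt_img m (Tinv j) = si" by (simp add: Tinv_def si_def img_add img_mult)
  then show "bt_img m (Tf j * Tinv j) = bt_img m 1" "bt_img m (Tinv j * Tf j) = bt_img m 1"
    by (simp_all add: img_mult s_si si_s)
qed

text \<open>These span, modulo the relations, the subalgebra generated by \<open>Tf k\<close> and
  \<open>Ef k\<close>.\<close>

definition top_elems :: "nat \<Rightarrow> free set" where
  "top_elems k = {1, Tf k, Ef k, Ef k * Tf k}"

lemma top_elems_mem [simp]: "1 \<in> top_elems k" "Tf k \<in> top_elems k" "Ef k \<in> top_elems k" "Ef k * Tf k \<in> top_elems k"
  by (auto simp: top_elems_def)

lemma top_elems_in_F: "g \<in> top_elems k \<Longrightarrow> 1 \<le> k \<Longrightarrow> k < m \<Longrightarrow> g \<in> F m"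
  by (auto simp: top_elems_def)

lemma img_commute_F:
  assumes "a \<in> F j" and "\<And>x. 1 \<le> gen_index x \<Longrightarrow> gen_index x < j \<Longrightarrow> bt_img m (fgen x) * bt_img m y = bt_img m y * bt_img m (fgen x)"
  shows "bt_img m (a * y) = bt_img m (y * a)"
  using assms(1)
proof (induction a rule: F_induct)
  case (scal c)
  show ?case by (simp add: fscal_central)
next
  case (add f g)
  then show ?case by (simp add: distrib_left distrib_right img_add)
next
  case (gen x f)
  have "bt_img m (fgen x * f * y) = bt_img m (fgen x) * bt_img m (y * f)"
    using gen.IH by (simp add: img_mult mult.assoc)
  also have "\<dots> = bt_img m (y * (fgen x * f))"
    using assms(2)[OF gen.hyps(2,3)] by (metis mult.assoc img_mult)
  finally show ?case .
qed

text \<open>Generators occurring in \<open>a\<close> have index below \<open>j\<close>, hence differ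
  from \<open>i\<close> by at least two.\<close>

lemma img_commute_gen:
  assumes "a \<in> F j" "j < i" "i < m"
  shows "bt_img m (a * Tf i) = bt_img m (Tf i * a)" "bt_img m (a * Ef i) = bt_img m (Ef i * a)"
proof -
  have "bt_img m (fgen x) * bt_img m (Tf i) = bt_img m (Tf i) * bt_img m (fgen x) \<and>
      bt_img m (fgen x) * bt_img m (Ef i) = bt_img m (Ef i) * bt_img m (fgen x)"
    if "1 \<le> gen_index x" "gen_index x < j" for x
  proof (cases x)
    case (T l)
    then have "1 \<le> l" "l < m" "1 \<le> i" "i < m" "far l i" "far i l" using that assms by auto
    with img_far[of l m i] img_far[of i m l] show ?thesis unfolding T by (simp flip: img_mult)
  next
    case (E l)
    then have "1 \<le> l" "l < m" "1 \<le> i" "i < m" "far l i" "far i l" using that assms by auto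
    with img_far[of l m i] img_far[of i m l] img_Ec[of l m i] show ?thesis unfolding E by (simp flip: img_mult)
  qed
  then show "bt_img m (a * Tf i) = bt_img m (Tf i * a)" "bt_img m (a * Ef i) = bt_img m (Ef i * a)"
    using img_commute_F[OF assms(1)] by blast+
qed

lemma img_commute_Tinv:
  assumes "a \<in> F j" "j < i" "i < m"
  shows "bt_img m (a * Tinv i) = bt_img m (Tinv i * a)"
proof -
  have T: "bt_img m a * bt_img m (Tf i) = bt_img m (Tf i) * bt_img m a" and E: "bt_img m a * bt_img m (Ef i) = bt_img m (Ef i) * bt_img m a"
    using img_commute_gen[OF assms] by (simp_all flip: img_mult)
  have W: "bt_img m a * bt_img m ww = bt_img m ww * bt_img m a" by (simp add: fscal_central flip: img_mult)
  have ext: "x * y = y * x \<Longrightarrow> x * (y * z) = y * (x * z)" for x y z :: bt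
    by (metis mult.assoc)
  show ?thesis
    by (simp add: Tinv_def img_mult img_add distrib_left distrib_right mult.assoc T E ext[OF T] ext[OF E] ext[OF W])
qed

text \<open>Sums of words in which the index \<open>k\<close> occurs through one factor only,
  saturated under equality in \<open>BT m\<close>. The ambient \<open>m\<close> stays fixed while
  \<open>k\<close> varies in the induction; scalars are absorbed into \<open>a\<close>.\<close>

inductive_set normal_span :: "nat \<Rightarrow> nat \<Rightarrow> free set" for m k where
  base: "a \<in> F k \<Longrightarrow> g \<in> top_elems k \<Longrightarrow> b \<in> F k \<Longrightarrow> a * g * b \<in> normal_span m k"
| add: "x \<in> normal_span m k \<Longrightarrow> y \<in> normal_span m k \<Longrightarrow> x + y \<in> normal_span m k"
| cong: "x \<in> normal_span m k \<Longrightarrow> bt_img m x = bt_img m y \<Longrightarrow> y \<in> normal_span m k"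

lemma normal_span_left: "x \<in> normal_span m k \<Longrightarrow> a \<in> F k \<Longrightarrow> a * x \<in> normal_span m k"
proof (induction rule: normal_span.induct)
  case (base a' g b)
  then show ?case using normal_span.base[of "a * a'" k g b m] by (simp add: mult.assoc)
next
  case (add x y)
  then show ?case by (simp add: distrib_left normal_span.add)
next
  case (cong x y)
  then show ?case using normal_span.cong[of "a * x" m k "a * y"] by (simp add: img_mult)
qed

lemma normal_span_right: "x \<in> normal_span m k \<Longrightarrow> a \<in> F k \<Longrightarrow> x * a \<in> normal_span m k"
proof (induction rule: normal_span.induct)
  case (base a' g b)
  then show ?case using normal_span.base[of a' k g "b * a" m] by (simp add: mult.assoc)
next
  case (add x y)
  then show ?case by (simp add: distrib_right normal_span.add)
next
  case (cong x y)
  then show ?case using normal_span.cong[of "x * a" m k "y * a"] by (simp add: img_mult)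
qed

lemma normal_span_eqI: "bt_img m x = bt_img m (a * g * b) \<Longrightarrow> a \<in> F k \<Longrightarrow> g \<in> top_elems k \<Longrightarrow> b \<in> F k \<Longrightarrow> x \<in> normal_span m k"
  by (metis normal_span.base normal_span.cong)

lemma normal_span_top: "g \<in> top_elems k \<Longrightarrow> g \<in> normal_span m k"
  using normal_span.base[of 1 k g 1 m] by simp

lemma normal_span_fscal_top: "g \<in> top_elems k \<Longrightarrow> fscal c * g \<in> normal_span m k"
  by (simp add: normal_span_left normal_span_top)

text \<open>The quadratic relation, idempotence of \<open>Ef k\<close> and its commuting with
  \<open>Tf k\<close> reduce every product of two factors of index \<open>k\<close>.\<close>

lemma gen_mult_top:
  assumes "1 \<le> k" "k < m" "L \<in> {Tf k, Ef k}" "g \<in> top_elems k"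
  shows "L * g \<in> normal_span m k"
proof -
  interpret bt_single "bt_img m 1" "bt_img m vv" "bt_img m ww" "bt_img m (Tf k)" "bt_img m (Ef k)"
    by (rule bt_single_img[OF assms(1,2)])
  note rules = img_add img_mult nf quad fs[symmetric] fs[symmetric, THEN assoc_ext]
  have "bt_img m (1 + (vv * Ef k + vv * (Ef k * Tf k))) = bt_img m (Tf k * Tf k)"
    "bt_img m (Ef k + (vv * Ef k + vv * (Ef k * Tf k))) = bt_img m (Tf k * (Ef k * Tf k))"
    "bt_img m (Ef k * Tf k) = bt_img m (Tf k * Ef k)"
    "bt_img m (Ef k) = bt_img m (Ef k * Ef k)"
    "bt_img m (Ef k * Tf k) = bt_img m (Ef k * (Ef k * Tf k))"
    by (simp_all add: rules)
  note eqs = this[THEN normal_span.cong[rotated]]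
  have "Tf k * Tf k \<in> normal_span m k" "Tf k * (Ef k * Tf k) \<in> normal_span m k" "Tf k * Ef k \<in> normal_span m k"
    "Ef k * Ef k \<in> normal_span m k" "Ef k * (Ef k * Tf k) \<in> normal_span m k"
    by (rule eqs; (rule normal_span.add normal_span_fscal_top normal_span_top top_elems_mem)+)+
  moreover have "Tf k \<in> normal_span m k" "Ef k \<in> normal_span m k" "Ef k * Tf k \<in> normal_span m k"
    by (simp_all add: normal_span_top)
  ultimately show ?thesis using assms(3,4) by (auto simp: top_elems_def)
qed

text \<open>The core of the spanning result: two factors of index \<open>j + 1\<close> around one of
  index \<open>j\<close> merge into one. If the inner or the right factor is 1, this is a basis word
  already or \<open>gen_mult_top\<close>.\<close>

lemma sandwich:
  assumes j: "1 \<le> j" "Suc j < m" and L: "L \<in> {Tf (Suc j), Ef (Suc j)}" and h: "h \<in> top_elems j" and g: "g \<in> top_elems (Suc j)"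
  shows "L * h * g \<in> normal_span m (Suc j)"
proof (cases "h = 1 \<or> g = 1")
  case True
  then show ?thesis
    using gen_mult_top[OF _ j(2) L g] L j h normal_span.base[of 1 "Suc j" L h m] by (auto simp: top_elems_in_F)
next
  case False
  define k where "k = Suc j"
  have mem: "Tf j \<in> F k" "Ef j \<in> F k" "Tinv j \<in> F k"
    using j by (simp_all add: k_def)
  interpret bt_pair "bt_img m 1" "bt_img m vv" "bt_img m ww" "bt_img m (Tf j)" "bt_img m (Ef j)" "bt_img m (Tf k)" "bt_img m (Ef k)"
    using j by (intro bt_pair_img) (auto simp: k_def)
  have si: "bt_img m (Tinv j) = si" by (simp add: Tinv_def si_def img_add img_mult)
  note I = normal_span_eqI[where k = k and m = m]
  note qs = img_mult[symmetric]
  \<comment> \<open>Eighteen cases remain: the \<open>t\<close> facts have \<open>L = Tf k\<close>,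
    the \<open>e\<close> facts \<open>L = Ef k\<close>. Only \<open>t4\<close>, \<open>t6\<close>
    and \<open>t7\<close> produce more than one summand.\<close>
  have t: "Tf k * Tf j * Tf k \<in> normal_span m k"
    by (rule I[of _ "Tf j" "Tf k" "Tf j"]) (use mem sandwiches_t in \<open>simp_all add: img_mult\<close>)
  have t2: "Tf k * Tf j * Ef k \<in> normal_span m k"
    by (rule I[of _ "Ef j" "Tf k" "Tf j"]) (use mem sandwiches_t in \<open>simp_all add: img_mult\<close>)
  have t3: "Tf k * Tf j * (Ef k * Tf k) \<in> normal_span m k"
    by (rule I[of _ "Ef j * Tf j" "Tf k" "Tf j"]) (use mem sandwiches_t in \<open>simp_all add: img_mult\<close>)
  have t4: "Tf k * Ef j * Tf k \<in> normal_span m k"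
  proof (rule normal_span.cong)
    show "Tf j * Ef k * Tinv j + vv * Ef j * Ef k * 1 + vv * Ef j * (Ef k * Tf k) * 1 \<in> normal_span m k"
      using mem by (intro normal_span.add normal_span.base) simp_all
    show "bt_img m (Tf j * Ef k * Tinv j + vv * Ef j * Ef k * 1 + vv * Ef j * (Ef k * Tf k) * 1)
      = bt_img m (Tf k * Ef j * Tf k)"
      using sand_tft by (simp add: img_add img_mult si mult.assoc)
  qed
  have t5: "Tf k * Ef j * Ef k \<in> normal_span m k"
    by (rule I[of _ "Ef j" "Ef k * Tf k" 1]) (use mem sandwiches_t in \<open>simp_all add: img_mult\<close>)
  have t6: "Tf k * Ef j * (Ef k * Tf k) \<in> normal_span m k"
  proof (rule normal_span.cong)
    show "Ef j * Ef k * 1 + vv * Ef j * Ef k * 1 + vv * Ef j * (Ef k * Tf k) * 1 \<in> normal_span m k"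
      using mem by (intro normal_span.add normal_span.base) simp_all
    show "bt_img m (Ef j * Ef k * 1 + vv * Ef j * Ef k * 1 + vv * Ef j * (Ef k * Tf k) * 1)
      = bt_img m (Tf k * Ef j * (Ef k * Tf k))"
      using sandwiches_t(5) by (simp add: img_add img_mult)
  qed
  have t7: "Tf k * (Ef j * Tf j) * Tf k \<in> normal_span m k"
  proof (rule normal_span.cong)
    show "Tf j * (Ef k * Tf k) * Tinv j + vv * Tf j * Ef j * (Ef k * Tf k) * Tinv j
      + vv * Tf j * Ef j * (Ef k * Tf k) * 1 \<in> normal_span m k"
      using mem by (intro normal_span.add normal_span.base) simp_all
    show "bt_img m (Tf j * (Ef k * Tf k) * Tinv j + vv * Tf j * Ef j * (Ef k * Tf k) * Tinv j
      + vv * Tf j * Ef j * (Ef k * Tf k) * 1) = bt_img m (Tf k * (Ef j * Tf j) * Tf k)"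
      unfolding img_mult img_add si sand_tfst using et by (simp add: mult.assoc t.base)
  qed
  have t8: "Tf k * (Ef j * Tf j) * Ef k \<in> normal_span m k"
    by (rule I[of _ "Ef j" "Ef k * Tf k" "Tf j"]) (use mem sandwiches_t in \<open>simp_all add: img_mult\<close>)
  have t9: "Tf k * (Ef j * Tf j) * (Ef k * Tf k) \<in> normal_span m k"
    by (rule I[of _ "Tf j * Ef j" "Ef k * Tf k" "Tf j"]) (use mem sandwiches_t in \<open>simp_all add: img_mult\<close>)
  have e: "Ef k * Tf j * Tf k \<in> normal_span m k"
    by (rule I[of _ "Tf j" "Tf k" "Ef j"]) (use mem sandwiches_e in \<open>simp_all add: img_mult\<close>)
  have e2: "Ef k * Tf j * Ef k \<in> normal_span m k"
    by (rule I[of _ "Tf j * Ef j" "Ef k" 1]) (use mem sandwiches_e in \<open>simp_all add: img_mult\<close>)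
  have e3: "Ef k * Tf j * (Ef k * Tf k) \<in> normal_span m k"
    by (rule I[of _ "Tf j * Ef j" "Ef k * Tf k" 1]) (use mem sandwiches_e in \<open>simp_all add: img_mult\<close>)
  have e4: "Ef k * Ef j * Tf k \<in> normal_span m k"
    by (rule I[of _ "Ef j" "Ef k * Tf k" 1]) (use mem sandwiches_e in \<open>simp_all add: img_mult\<close>)
  have e5: "Ef k * Ef j * Ef k \<in> normal_span m k"
    by (rule I[of _ "Ef j" "Ef k" 1]) (use mem sandwiches_e in \<open>simp_all add: img_mult\<close>)
  have e6: "Ef k * Ef j * (Ef k * Tf k) \<in> normal_span m k"
    by (rule I[of _ "Ef j" "Ef k * Tf k" 1]) (use mem sandwiches_e in \<open>simp_all add: img_mult\<close>)
  have e7: "Ef k * (Ef j * Tf j) * Tf k \<in> normal_span m k"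
    by (rule I[of _ "Tf j * Ef j" "Ef k * Tf k" 1]) (use mem sandwiches_e in \<open>simp_all add: img_mult\<close>)
  have e8: "Ef k * (Ef j * Tf j) * Ef k \<in> normal_span m k"
    by (rule I[of _ "Tf j * Ef j" "Ef k" 1]) (use mem sandwiches_e in \<open>simp_all add: img_mult\<close>)
  have e9: "Ef k * (Ef j * Tf j) * (Ef k * Tf k) \<in> normal_span m k"
    by (rule I[of _ "Tf j * Ef j" "Ef k * Tf k" 1]) (use mem sandwiches_e in \<open>simp_all add: img_mult\<close>)
  have "L = Tf k \<or> L = Ef k" "h = Tf j \<or> h = Ef j \<or> h = Ef j * Tf j" "g = Tf k \<or> g = Ef k \<or> g = Ef k * Tf k"
    using L h g False by (auto simp: top_elems_def k_def)
  then show ?thesis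
    using t t2 t3 t4 t5 t6 t7 t8 t9 e e2 e3 e4 e5 e6 e7 e8 e9 unfolding k_def[symmetric]
    by (elim disjE) simp_all
qed

text \<open>The indices in \<open>a\<close> are at most \<open>k - 2\<close>, so \<open>a\<close>
  can be moved in front of \<open>L\<close>.\<close>

lemma gen_mult_F_span:
  assumes "a \<in> F j" "j < k" "1 \<le> k" "k < m" "L \<in> {Tf k, Ef k}" "x \<in> normal_span m k" "L * x \<in> normal_span m k"
  shows "L * (a * x) \<in> normal_span m k"
proof (rule normal_span.cong)
  show "a * (L * x) \<in> normal_span m k"
    using assms F_mono[OF assms(1), of k] by (simp add: normal_span_left)
  have "bt_img m (a * L) = bt_img m (L * a)"
    using img_commute_gen[OF assms(1,2,4)] assms(5) by auto
  then show "bt_img m (a * (L * x)) = bt_img m (L * (a * x))"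
    by (metis mult.assoc img_mult)
qed

text \<open>The span contains the scalars and is stable under left multiplication by
  \<open>F k\<close>, so only left multiplication by \<open>Tf k\<close> and \<open>Ef k\<close> has
  to be checked; right factors from \<open>F k\<close> are carried along.\<close>

lemma F_Suc_subset_normal_spanI:
  assumes k: "1 \<le> k" "k < m"
    and step: "\<And>L a g. L \<in> {Tf k, Ef k} \<Longrightarrow> a \<in> F k \<Longrightarrow> g \<in> top_elems k \<Longrightarrow> L * (a * g) \<in> normal_span m k"
  shows "F (Suc k) \<subseteq> normal_span m k"
proof
  have L: "L * x \<in> normal_span m k" if "x \<in> normal_span m k" and L: "L \<in> {Tf k, Ef k}" for L x
    using that(1)
  proof (induction rule: normal_span.induct)
    case (base a g b)
    then show ?case using normal_span_right[OF step[OF L base(1,2)] base(3)] by (simp add: mult.assoc)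
  next
    case (add x y)
    then show ?case by (simp add: distrib_left normal_span.add)
  next
    case (cong x y)
    then show ?case using normal_span.cong[of "L * x" m k "L * y"] by (simp add: img_mult)
  qed
  fix f assume "f \<in> F (Suc k)"
  then show "f \<in> normal_span m k"
  proof (induction f rule: F_induct)
    case (scal c)
    then show ?case using normal_span.base[of "fscal c" k 1 1 m] by simp
  next
    case (add f g)
    then show ?case by (simp add: normal_span.add)
  next
    case (gen x f)
    then consider "gen_index x < k" | "gen_index x = k" by linarith
    then show ?case
    proof cases
      case 1
      with gen show ?thesis by (intro normal_span_left) (auto simp: fgen_def)
    next
      case 2
      then have "fgen x \<in> {Tf k, Ef k}" by (cases x) auto
      then show ?thesis using L gen by blast
    qed
  qed
qed

text \<open>Induction on the index. In \<open>L * (a * g)\<close> the induction hypothesis writes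
  the middle part as a sum of terms \<open>a * h * b\<close> with \<open>a\<close> and
  \<open>b\<close> of still lower index; \<open>a\<close> moves left past \<open>L\<close>,
  \<open>b\<close> moves right past \<open>g\<close>, and \<open>sandwich\<close> treats
  \<open>L * h * g\<close>.\<close>

lemma F_Suc_subset_normal_span: "1 \<le> k \<Longrightarrow> k < m \<Longrightarrow> F (Suc k) \<subseteq> normal_span m k"
proof (induction k rule: nat_induct_at_least)
  case base
  \<comment> \<open>Both \<open>F 1\<close> and \<open>F 0\<close> consist of the scalars. The form
    \<open>F 0\<close> provides the strict inequality that \<open>gen_mult_F_span\<close> asks
    for.\<close>
  have "1 \<le> l \<and> l < 1 \<longleftrightarrow> 1 \<le> l \<and> l < 0" for l :: nat by linarith
  then have "F 1 = F 0" by (simp only: F_eq word_in_def)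
  with base show ?case
    by (intro F_Suc_subset_normal_spanI gen_mult_F_span[of _ 0] gen_mult_top normal_span_top) auto
next
  case (Suc j)
  show ?case
  proof (rule F_Suc_subset_normal_spanI)
    fix L a g
    assume L: "L \<in> {Tf (Suc j), Ef (Suc j)}" and a: "a \<in> F (Suc j)" and g: "g \<in> top_elems (Suc j)"
    from a have "a \<in> normal_span m j" using Suc by auto
    then show "L * (a * g) \<in> normal_span m (Suc j)"
    proof (induction rule: normal_span.induct)
      case (base a h b)
      have bg: "bt_img m (b * g) = bt_img m (g * b)"
        using img_commute_gen[OF base(3) _ Suc.prems] g
        by (auto simp: top_elems_def) (metis mult.assoc img_mult)
      have "b \<in> F (Suc j)" "h \<in> F (Suc j)"
        using base F_mono[of b j "Suc j"] top_elems_in_F Suc.hyps by auto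
      then have hgb: "h * g * b \<in> normal_span m (Suc j)" "L * (h * g * b) \<in> normal_span m (Suc j)"
        using normal_span.base[of h "Suc j" g b m] normal_span_right[OF sandwich[OF Suc.hyps Suc.prems L base(2) g], of b] g
        by (simp_all add: mult.assoc)
      have "L * (a * (h * g * b)) \<in> normal_span m (Suc j)"
        by (rule gen_mult_F_span[OF base(1)]) (use L hgb Suc.prems in auto)
      then show ?case by (rule normal_span.cong) (metis bg mult.assoc img_mult)
    next
      case (add x y)
      then show ?case by (simp add: distrib_left distrib_right normal_span.add)
    next
      case (cong x y)
      then show ?case using normal_span.cong[of "L * (x * g)" m "Suc j" "L * (y * g)"] by (simp add: img_mult)
    qed
  qed (use Suc in auto)
qed

section \<open>The trace functionals\<close>

lemma field_extensionD:
  assumes "field_extension \<phi>"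
  shows "\<phi> 1 = 1" "\<phi> (x + y) = \<phi> x + \<phi> y" "\<phi> (x * y) = \<phi> x * \<phi> y" "\<phi> 0 = 0" "\<phi> (x - y) = \<phi> x - \<phi> y"
    "x \<noteq> 0 \<Longrightarrow> \<phi> x \<noteq> 0"
proof -
  show 1: "\<phi> 1 = 1" and add: "\<phi> (x + y) = \<phi> x + \<phi> y" and mult: "\<phi> (x * y) = \<phi> x * \<phi> y" for x y
    using assms by (simp_all add: field_extension_def)
  show "\<phi> 0 = 0" using add[of 0 0] by (metis add.right_neutral add_left_cancel)
  show "\<phi> (x - y) = \<phi> x - \<phi> y" using add[of "x - y" y] by (simp add: algebra_simps)
  show "x \<noteq> 0 \<Longrightarrow> \<phi> x \<noteq> 0" using mult[of x "inverse x"] 1 by auto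
qed

locale markov =
  fixes \<phi> :: "K \<Rightarrow> 'l::field" and A B :: 'l and \<rho> :: "nat \<Rightarrow> free set \<Rightarrow> 'l"
  assumes extension: "field_extension \<phi>" and trace: "markov_trace \<phi> A B \<rho>"
begin

lemmas \<phi> = field_extensionD[OF extension]

definition tr :: "nat \<Rightarrow> free \<Rightarrow> 'l" where "tr m f = \<rho> m (bt_cls m f)"

lemma tr_cong: "bt_img m f = bt_img m g \<Longrightarrow> tr m f = tr m g"
  by (simp add: img_eq_iff tr_def)

lemma bt_cls_F: "f \<in> F m \<Longrightarrow> bt_cls m f = cls m (BT_rels m) f"
  by (simp add: bt_cls_def)

lemma BT_incl_cls: "f \<in> F m \<Longrightarrow> BT_incl m (bt_cls m f) = bt_cls (Suc m) f"
  using F_mono[of f m "Suc m"]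
  by (simp add: BT_incl_def bt_cls_F canon_cls[OF BT_rels_subset BT_rels_mono BT_rels_subset])

context
  fixes m :: nat
  assumes m: "1 \<le> m"
begin

lemma trace_m:
  "\<rho> m \<in> carrier (BT m) \<rightarrow>\<^sub>E K_adjoin \<phi> A B"
  "linear_map \<phi> (BT m) (\<rho> m)"
  "\<rho> m \<one>\<^bsub>BT m\<^esub> = 1"
  "x \<in> carrier (BT m) \<Longrightarrow> y \<in> carrier (BT m) \<Longrightarrow> \<rho> m (x \<otimes>\<^bsub>BT m\<^esub> y) = \<rho> m (y \<otimes>\<^bsub>BT m\<^esub> x)"
  "x \<in> carrier (BT m) \<Longrightarrow> \<rho> (Suc m) (BT_incl m x \<otimes>\<^bsub>BT (Suc m)\<^esub> BT_T (Suc m) m) = A * \<rho> m x"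
  "x \<in> carrier (BT m) \<Longrightarrow>
    \<rho> (Suc m) (BT_incl m x \<otimes>\<^bsub>BT (Suc m)\<^esub> BT_E (Suc m) m \<otimes>\<^bsub>BT (Suc m)\<^esub> BT_T (Suc m) m) = A * \<rho> m x"
  "x \<in> carrier (BT m) \<Longrightarrow> \<rho> (Suc m) (BT_incl m x \<otimes>\<^bsub>BT (Suc m)\<^esub> BT_E (Suc m) m) = B * \<rho> m x"
  using trace m by (auto simp: markov_trace_def)

lemma tr_in_K_adjoin: "tr m f \<in> K_adjoin \<phi> A B"
  using trace_m(1) by (auto simp: tr_def)

lemma tr_add: "tr m (f + g) = tr m f + tr m g"
  using trace_m(2) by (simp add: tr_def linear_map_def bt_cls_add)

lemma tr_scal: "tr m (fscal c * f) = \<phi> c * tr m f"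
  using trace_m(2) by (simp add: tr_def linear_map_def bt_cls_scal)

lemma tr_one: "tr m 1 = 1"
  using trace_m(3) by (simp add: tr_def BT_def presented_sel bt_cls_F)

lemma tr_comm: "tr m (f * g) = tr m (g * f)"
  using trace_m(4) by (simp add: tr_def bt_cls_mult)

lemma tr_rules:
  assumes "f \<in> F m"
  shows "tr (Suc m) (f * Tf m) = A * tr m f" "tr (Suc m) (f * (Ef m * Tf m)) = A * tr m f"
    "tr (Suc m) (f * Ef m) = B * tr m f"
proof -
  have TE: "BT_T (Suc m) m = bt_cls (Suc m) (Tf m)" "BT_E (Suc m) m = bt_cls (Suc m) (Ef m)"
    using m by (simp_all add: BT_T_def BT_E_def bt_cls_F)
  show "tr (Suc m) (f * Tf m) = A * tr m f" "tr (Suc m) (f * (Ef m * Tf m)) = A * tr m f"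
    "tr (Suc m) (f * Ef m) = B * tr m f"
    using trace_m(5-7)[of "bt_cls m f"] unfolding TE BT_incl_cls[OF assms] bt_cls_mult[symmetric]
    by (simp_all add: tr_def mult.assoc)
qed

lemma tr_zero: "tr m 0 = 0"
  using tr_add[of 0 0] by (metis add.right_neutral add_left_cancel)

end

text \<open>The three stripping rules of the trace in one format: a family of elements indexed by
  \<open>k\<close>, with the factor that replaces it.\<close>

definition top_rules :: "((nat \<Rightarrow> free) \<times> 'l) set" where
  "top_rules = {(\<lambda>k. Tf k, A), (\<lambda>k. Ef k, B), (\<lambda>k. Ef k * Tf k, A)}"

text \<open>Conjugation by \<open>Tf (j + 1) * Tf j\<close> raises the index: for \<open>Tf\<close>
  this is the braid relation, for \<open>Ef\<close> the last relation of the presentation, and the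
  mixed case combines both.\<close>

lemma img_shift:
  assumes "(g, c) \<in> top_rules" "1 \<le> j" "Suc j < m"
  shows "bt_img m (g j * Tf (Suc j) * Tf j) = bt_img m (Tf (Suc j) * Tf j * g (Suc j))"
proof -
  define k where "k = Suc j"
  interpret bt_pair "bt_img m 1" "bt_img m vv" "bt_img m ww" "bt_img m (Tf j)" "bt_img m (Ef j)" "bt_img m (Tf k)" "bt_img m (Ef k)"
    using assms by (intro bt_pair_img) (auto simp: k_def)
  have "bt_img m (Ef j * Tf j * Tf k * Tf j) = bt_img m (Tf k * Tf j * (Ef k * Tf k))"
    unfolding img_mult by (metis mult.assoc fts braid)
  then show ?thesis
    using assms(1) fts braid by (auto simp: top_rules_def k_def[symmetric] img_mult)
qed

text \<open>The trace axioms give the case \<open>j = m - 1\<close>. Since the right-hand side does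
  not involve \<open>j\<close>, a downward induction by \<open>img_shift\<close> reaches all smaller
  indices.\<close>

lemma tr_top_rules:
  assumes "(g, c) \<in> top_rules" "j < m" "1 \<le> j" "y \<in> F j"
  shows "tr m (y * g j) = c * tr (m - 1) y"
proof -
  obtain n where m: "m = Suc n" using assms(2) by (cases m) auto
  have "tr (Suc n) (y * g j) = c * tr n y" if "j \<le> n" "1 \<le> j" "y \<in> F j"
    using that
  proof (induction j arbitrary: y rule: inc_induct)
    case base
    then show ?case using assms(1) tr_rules by (auto simp: top_rules_def)
  next
    case (step j)
    define i where "i = Suc j"
    note n = tr_cong[where m = n] and sn = tr_cong[where m = "Suc n"]
    have ij: "1 \<le> j" "j < n" "1 \<le> i" "i < Suc n" "1 \<le> n" using step by (auto simp: i_def)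
    note Ti = img_Tinv[OF ij(3,4)] and Tj = img_Tinv[of j "Suc n"] img_Tinv[OF ij(1,2)]
    have mem: "y \<in> F n" "Tinv j \<in> F n" "Tf j \<in> F n" "y \<in> F i" "Tinv j \<in> F i" "Tf j \<in> F i"
      using ij step.prems F_mono[of y j] by (auto simp: i_def)
    \<comment> \<open>Conjugating by \<open>Tf i * Tf j\<close> turns \<open>g j\<close> into
      \<open>g i\<close>, while \<open>Tinv i\<close> passes through \<open>y\<close> and cancels.
      What precedes \<open>g i\<close> is \<open>Tinv j * y * Tf j\<close>, which lies in
      \<open>F i\<close> and no longer in \<open>F j\<close>; this is why \<open>y\<close> is
      arbitrary in the induction. After stripping, the conjugation is undone by cyclicity in
      \<open>BT n\<close>.\<close>
    have "tr (Suc n) (y * g j) = tr (Suc n) (y * g j * (Tf i * Tinv i))"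
      by (rule sn) (simp add: img_mult[of _ _ "Tf i * Tinv i"] Ti img_one)
    also have "\<dots> = tr (Suc n) (Tinv i * (y * g j * Tf i))"
      by (subst (2) tr_comm) (simp_all add: mult.assoc)
    also have "\<dots> = tr (Suc n) (Tinv i * (y * g j * Tf i) * (Tf j * Tinv j))"
      using ij by (intro sn) (simp add: img_mult[of _ _ "Tf j * Tinv j"] Tj img_one)
    also have "\<dots> = tr (Suc n) (y * (Tinv i * Tf i) * Tf j * g i * Tinv j)"
    proof (rule sn)
      have "bt_img (Suc n) (Tinv i * (y * g j * Tf i) * (Tf j * Tinv j))
        = bt_img (Suc n) (Tinv i * y) * bt_img (Suc n) (g j * Tf i * Tf j) * bt_img (Suc n) (Tinv j)"
        by (simp add: img_mult mult.assoc)
      also have "\<dots> = bt_img (Suc n) (y * Tinv i) * bt_img (Suc n) (Tf i * Tf j * g i) * bt_img (Suc n) (Tinv j)"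
        using img_commute_Tinv[OF step.prems(2), of i "Suc n"] img_shift[OF assms(1), of j "Suc n"] ij
        by (simp add: i_def)
      finally show "bt_img (Suc n) (Tinv i * (y * g j * Tf i) * (Tf j * Tinv j))
        = bt_img (Suc n) (y * (Tinv i * Tf i) * Tf j * g i * Tinv j)"
        by (simp add: img_mult mult.assoc)
    qed
    also have "\<dots> = tr (Suc n) (y * Tf j * g i * Tinv j)"
      by (rule sn) (simp add: img_mult[of _ y "Tinv i * Tf i"] img_mult[of _ "y * _"] img_mult Ti[unfolded img_mult] img_one)
    also have "\<dots> = tr (Suc n) (Tinv j * y * Tf j * g i)"
      by (subst tr_comm) (simp_all add: mult.assoc)
    also have "\<dots> = c * tr n (Tinv j * y * Tf j)"
      using step.IH[of "Tinv j * y * Tf j"] mem by (simp add: i_def)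
    also have "tr n (Tinv j * y * Tf j) = tr n (y * (Tf j * Tinv j))"
      using tr_comm[OF ij(5), of "Tinv j" "y * Tf j"] by (simp add: mult.assoc)
    also have "\<dots> = tr n y"
      by (rule n) (simp add: img_mult[of _ y] Tj img_one)
    finally show ?case .
  qed
  with assms m show ?thesis by simp
qed

end

section \<open>The Partition Temperley--Lieb relation\<close>

definition ptl_elem :: "nat \<Rightarrow> nat \<Rightarrow> free" where
  "ptl_elem i j = Ef i * Ef j * T2f i j"

lemma ptl_elem_in_F [simp]: "1 \<le> i \<Longrightarrow> i < m \<Longrightarrow> 1 \<le> j \<Longrightarrow> j < m \<Longrightarrow> ptl_elem i j \<in> F m"
  by (simp add: ptl_elem_def T2f_def)

lemma img_ptl_elem:
  assumes "1 \<le> i" "i < m" "1 \<le> j" "j < m" "adj i j"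
  shows "bt_img m (ptl_elem i j) = bt_img m (ptl_elem j i)" "bt_img m (Tf i * ptl_elem i j) = bt_img m (fscal u * ptl_elem i j)"
    "bt_img m (Ef i * ptl_elem i j) = bt_img m (ptl_elem i j)"
proof -
  interpret bt_pair "bt_img m 1" "bt_img m vv" "bt_img m ww" "bt_img m (Tf j)" "bt_img m (Ef j)" "bt_img m (Tf i)" "bt_img m (Ef i)"
    by (rule bt_pair_img[OF assms])
  have ptl_elem: "bt_img m (ptl_elem i j) = sym_elem"
    by (simp add: sym_elem_def ptl_elem_def T2f_def img_add img_mult)
  moreover have "bt_img m (ptl_elem j i) = sym_elem"
    unfolding sym_elem_swap[symmetric] by (simp add: ptl_elem_def T2f_def img_add img_mult)
  ultimately show "bt_img m (ptl_elem i j) = bt_img m (ptl_elem j i)" by simp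
  show "bt_img m (Ef i * ptl_elem i j) = bt_img m (ptl_elem i j)"
    by (simp add: img_mult ptl_elem e_sym_elem)
  have "bt_img m (fscal u * ptl_elem i j) = bt_img m ((1 + vv) * ptl_elem i j)"
    by (simp flip: fscal_1 fscal_add)
  then show "bt_img m (Tf i * ptl_elem i j) = bt_img m (fscal u * ptl_elem i j)"
    by (simp only: img_mult img_add ptl_elem t_sym_elem distrib_right)
qed

text \<open>Each generator of \<open>BT 3\<close> multiplies \<open>ptl_elem 1 2\<close> by
  \<open>u\<close> or 1. For those of index 2 the symmetry of \<open>ptl_elem\<close> in its indices
  is used.\<close>

lemma img_ptl_elem_scalar:
  assumes "3 \<le> m" "x \<in> F 3"
  shows "\<exists>c. bt_img m (x * ptl_elem 1 2) = bt_img m (fscal c * ptl_elem 1 2)"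
  using assms(2)
proof (induction x rule: F_induct)
  case (scal c)
  then show ?case by blast
next
  case (add f g)
  then obtain a b where "bt_img m (f * ptl_elem 1 2) = bt_img m (fscal a * ptl_elem 1 2)" "bt_img m (g * ptl_elem 1 2) = bt_img m (fscal b * ptl_elem 1 2)"
    by blast
  then have "bt_img m ((f + g) * ptl_elem 1 2) = bt_img m (fscal (a + b) * ptl_elem 1 2)"
    by (simp add: distrib_right img_add fscal_add)
  then show ?case by blast
next
  case (gen x f)
  then obtain a where a: "bt_img m (f * ptl_elem 1 2) = bt_img m (fscal a * ptl_elem 1 2)" by blast
  have "\<exists>b. bt_img m (fgen x * ptl_elem 1 2) = bt_img m (fscal b * ptl_elem 1 2)"
  proof -
    have "x \<in> {T 1, T 2, E 1, E 2}"
      using gen.hyps by (cases x) auto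
    moreover have "bt_img m (Tf 2 * ptl_elem 1 2) = bt_img m (fscal u * ptl_elem 1 2)" "bt_img m (Ef 2 * ptl_elem 1 2) = bt_img m (fscal 1 * ptl_elem 1 2)"
      using img_ptl_elem[of 2 m 1] assms by (simp_all add: img_mult fscal_1 img_one)
    moreover have "bt_img m (Tf 1 * ptl_elem 1 2) = bt_img m (fscal u * ptl_elem 1 2)" "bt_img m (Ef 1 * ptl_elem 1 2) = bt_img m (fscal 1 * ptl_elem 1 2)"
      using img_ptl_elem[of 1 m 2] assms by (simp_all add: fscal_1)
    ultimately show ?thesis by blast
  qed
  then obtain b where b: "bt_img m (fgen x * ptl_elem 1 2) = bt_img m (fscal b * ptl_elem 1 2)" by blast
  have "bt_img m (fgen x * f * ptl_elem 1 2) = bt_img m (fgen x * fscal a * ptl_elem 1 2)"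
    using a by (simp add: img_mult mult.assoc)
  also have "\<dots> = bt_img m (fscal a) * bt_img m (fgen x * ptl_elem 1 2)"
    by (simp add: fscal_central[of "fgen x"] img_mult mult.assoc)
  also have "\<dots> = bt_img m (fscal (a * b) * ptl_elem 1 2)"
    unfolding b by (simp add: img_mult fscal_mult mult.assoc)
  finally show ?case by blast
qed

text \<open>\<open>W\<close> intertwines each generator of index \<open>i\<close> or
  \<open>i + 1\<close> with the one of the next index, hence also the corresponding elements
  \<open>ptl_elem\<close>.\<close>

lemma img_ptl_elem_shift:
  assumes i: "1 \<le> i" "Suc (Suc i) < m"
  defines "W \<equiv> Tf i * Tf (Suc i) * Tf (Suc (Suc i))"
  shows "bt_img m (ptl_elem (Suc i) (Suc (Suc i)) * W) = bt_img m (W * ptl_elem i (Suc i))"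
proof -
  define j k where "j = Suc i" and "k = Suc j"
  have b: "1 \<le> i" "i < m" "1 \<le> j" "j < m" "1 \<le> k" "k < m" and a: "adj j i" "adj k j" "adj i j" "adj j k" "far i k" "far k i"
    using i by (simp_all add: j_def k_def)
  note ji = img_adj[OF b(3,4,1,2) a(1), unfolded img_mult] and kj = img_adj[OF b(5,6,3,4) a(2), unfolded img_mult]
    and ik = img_far[OF b(1,2,5,6) a(5), unfolded img_mult] and ki = img_far[OF b(5,6,1,2) a(6), unfolded img_mult]
  define w where "w = bt_img m W"
  have w: "w = bt_img m (Tf i) * bt_img m (Tf j) * bt_img m (Tf k)"
    by (simp add: w_def W_def img_mult j_def k_def)
  \<comment> \<open>An adjacent relation is applied to two neighbouring factors of \<open>w\<close>,
    and the third factor is passed by far commutation: it stands last in \<open>left\<close> and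
    first in \<open>right\<close>.\<close>
  have left: "x * (a * b * c) = a * b * c * y" if "x * a * b = a * b * y" "y * c = c * y" for x y a b c :: bt
    using that by (simp flip: mult.assoc) (simp add: mult.assoc)
  have right: "x * (a * b * c) = a * b * c * y" if "x * a = a * x" "x * b * c = b * c * y" for x y a b c :: bt
  proof -
    have "x * (a * b * c) = a * (x * b * c)" using that(1) by (simp flip: mult.assoc)
    then show ?thesis using that(2) by (simp add: mult.assoc)
  qed
  have T: "bt_img m (Tf j) * w = w * bt_img m (Tf i)" "bt_img m (Tf k) * w = w * bt_img m (Tf j)"
    unfolding w by (rule left[OF ji(1) ik(1)], rule right[OF ki(1) kj(1)])
  have E: "bt_img m (Ef j) * w = w * bt_img m (Ef i)" "bt_img m (Ef k) * w = w * bt_img m (Ef j)"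
    unfolding w by (rule left[OF ji(4) ik(2)], rule right[OF ki(2) kj(4)])
  have ext: "x * w = w * y \<Longrightarrow> x * (w * t) = w * (y * t)" for x y t
    by (metis mult.assoc)
  have one: "bt_img m 1 * w = w" "w * bt_img m 1 = w" by (simp_all add: w_def img_one)
  have "bt_img m (ptl_elem j k) * w = w * bt_img m (ptl_elem i j)"
    by (simp add: ptl_elem_def T2f_def img_add img_mult distrib_left distrib_right mult.assoc T E T[THEN ext] E[THEN ext] one)
  then show ?thesis by (simp add: w_def img_mult j_def k_def)
qed

section \<open>The trace of the additional relators\<close>

context markov
begin

text \<open>Cyclicity and the commuting of \<open>Ef 1 * Ef 2\<close> with \<open>Tf 1\<close> put
  the index 2 of each of the six terms last, as \<open>Ef 2\<close> or \<open>Ef 2 * Tf 2\<close>.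
  Stripping it leaves a trace of elements of index 1, and the six values add up to the
  product.\<close>

lemma tr_ptl_elem:
  assumes "3 \<le> m"
  shows "tr m (ptl_elem 1 2) = (A + B) * (B + (1 + \<phi> u) * A)"
proof -
  define n where "n = m - 1"
  have n: "1 \<le> n" "1 < n" "n - 1 \<ge> 1" and m: "1 \<le> m" using assms by (auto simp: n_def)
  have top_rules: "(\<lambda>k. Tf k, A) \<in> top_rules" "(\<lambda>k. Ef k, B) \<in> top_rules" "(\<lambda>k. Ef k * Tf k, A) \<in> top_rules"
    by (simp_all add: top_rules_def)
  have top: "tr m (y * Ef 2) = B * tr n y" "tr m (y * (Ef 2 * Tf 2)) = A * tr n y" if "y \<in> F 2" for y
    using tr_top_rules[OF top_rules(2), of 2 m y] tr_top_rules[OF top_rules(3), of 2 m y] that assms by (simp_all add: n_def)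
  have E: "tr n (Ef 1) = B" and ET: "tr n (Ef 1 * Tf 1) = A"
    using tr_top_rules[OF top_rules(2), of 1 n 1] tr_top_rules[OF top_rules(3), of 1 n 1] n tr_one by simp_all
  then have TE: "tr n (Tf 1 * Ef 1) = A"
    using tr_comm[OF n(1), of "Tf 1" "Ef 1"] by simp
  interpret bt_single "bt_img n 1" "bt_img n vv" "bt_img n ww" "bt_img n (Tf 1)" "bt_img n (Ef 1)"
    using n by (intro bt_single_img) auto
  \<comment> \<open>The longest term leaves this element once its index 2 is stripped.\<close>
  have "bt_img n (Tf 1 * (Tf 1 * Ef 1)) = bt_img n (Ef 1 + vv * Ef 1 + vv * (Ef 1 * Tf 1))"
    by (simp add: img_add img_mult nf quad fs[symmetric] fs[symmetric, THEN assoc_ext] del: One_nat_def)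
  then have "tr n (Tf 1 * (Tf 1 * Ef 1)) = tr n (Ef 1 + vv * Ef 1 + vv * (Ef 1 * Tf 1))"
    by (rule tr_cong)
  then have TTE: "tr n (Tf 1 * (Tf 1 * Ef 1)) = B + (\<phi> u - 1) * B + (\<phi> u - 1) * A"
    using E ET n by (simp add: tr_add tr_scal \<phi>)
  have q12: "bt_img m (Ef 1 * Ef 2 * Tf 1) = bt_img m (Tf 1 * Ef 1 * Ef 2)"
    using img_adj(2)[of 1 m 2] assms by simp
  have mem: "Ef 1 \<in> F 2" "Tf 1 * Ef 1 \<in> F 2" "Tf 1 * (Tf 1 * Ef 1) \<in> F 2" by simp_all
  have 1: "tr m (Ef 1 * Ef 2) = B * B" using top mem E by simp
  have 2: "tr m (Ef 1 * Ef 2 * Tf 1) = B * A"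
    using top(1)[OF mem(2)] TE tr_cong[OF q12] by simp
  have 3: "tr m (Ef 1 * Ef 2 * Tf 2) = A * B"
    using top(2)[OF mem(1)] E by (simp add: mult.assoc)
  have 4: "tr m (Ef 1 * Ef 2 * (Tf 1 * Tf 2)) = A * A"
  proof -
    have "bt_img m (Ef 1 * Ef 2 * Tf 1 * Tf 2) = bt_img m (Tf 1 * Ef 1 * Ef 2 * Tf 2)"
      by (simp only: img_mult[of m _ "Tf 2"] q12)
    then have "tr m (Ef 1 * Ef 2 * Tf 1 * Tf 2) = tr m (Tf 1 * Ef 1 * Ef 2 * Tf 2)"
      by (rule tr_cong)
    then show ?thesis using top(2)[OF mem(2)] TE by (simp add: mult.assoc)
  qed
  have 5: "tr m (Ef 1 * Ef 2 * (Tf 2 * Tf 1)) = A * A"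
    using tr_comm[OF m, of "Ef 1 * Ef 2 * Tf 2" "Tf 1"] top(2)[OF mem(2)] TE by (simp add: mult.assoc)
  have 6: "tr m (Ef 1 * Ef 2 * (Tf 1 * Tf 2 * Tf 1)) = A * (B + (\<phi> u - 1) * B + (\<phi> u - 1) * A)"
  proof -
    have "tr m (Ef 1 * Ef 2 * (Tf 1 * Tf 2 * Tf 1)) = tr m (Tf 1 * (Ef 1 * Ef 2 * (Tf 1 * Tf 2)))"
      using tr_comm[OF m, of "Ef 1 * Ef 2 * (Tf 1 * Tf 2)" "Tf 1"] by (simp add: mult.assoc)
    also have "\<dots> = tr m (Tf 1 * (Tf 1 * Ef 1) * (Ef 2 * Tf 2))"
    proof (rule tr_cong)
      have "bt_img m (Tf 1 * (Ef 1 * Ef 2 * Tf 1) * Tf 2) = bt_img m (Tf 1 * (Tf 1 * Ef 1 * Ef 2) * Tf 2)"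
        by (simp only: img_mult[of m _ "Tf 2"] img_mult[of m "Tf 1"] q12)
      then show "bt_img m (Tf 1 * (Ef 1 * Ef 2 * (Tf 1 * Tf 2))) = bt_img m (Tf 1 * (Tf 1 * Ef 1) * (Ef 2 * Tf 2))"
        by (simp add: mult.assoc)
    qed
    finally show ?thesis using top(2)[OF mem(3)] TTE by (simp add: mult.assoc)
  qed
  show ?thesis
    using 1 2 3 4 5 6 m unfolding ptl_elem_def T2f_def by (simp add: distrib_left tr_add) (simp add: algebra_simps)
qed

text \<open>The induction is on \<open>k\<close> with \<open>m\<close> arbitrary, because stripping
  a factor of index \<open>k\<close> also lowers \<open>m\<close> by one.\<close>

lemma tr_ptl_elem_vanish:
  assumes z0: "(A + B) * (B + (1 + \<phi> u) * A) = 0"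
    and "3 \<le> k" "k \<le> m" "x \<in> F k"
  shows "tr m (x * ptl_elem 1 2) = 0"
  using assms(2-)
proof (induction k arbitrary: m x rule: nat_induct_at_least)
  case base
  then obtain c where "bt_img m (x * ptl_elem 1 2) = bt_img m (fscal c * ptl_elem 1 2)"
    using img_ptl_elem_scalar[of m x] by auto
  from tr_cong[OF this] show ?case using base z0 tr_ptl_elem[of m] by (simp add: tr_scal)
next
  case (Suc k)
  have m: "1 \<le> m" "1 \<le> m - 1" using Suc by auto
  have "x \<in> normal_span m k" using F_Suc_subset_normal_span[of k m] Suc by auto
  then show ?case
  proof (induction rule: normal_span.induct)
    case (base a g b)
    show ?case
    proof (cases "g = 1")
      case True
      then show ?thesis using Suc.IH[of m "a * b"] Suc.prems base by simp
    next
      case False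
      then obtain h c where h: "(h, c) \<in> top_rules" "g = h k" using base(2) by (auto simp: top_elems_def top_rules_def)
      \<comment> \<open>As \<open>k\<close> is at least 3, the relator lies below index
        \<open>k\<close>; after a rotation the factor \<open>g\<close> is last and everything before
        it is in \<open>F k\<close>.\<close>
      have "ptl_elem 1 2 \<in> F k" using Suc.hyps by simp
      then have "tr m (b * ptl_elem 1 2 * a * g) = c * tr (m - 1) (b * ptl_elem 1 2 * a)"
        using tr_top_rules[OF h(1), of k m "b * ptl_elem 1 2 * a"] base h Suc by simp
      also have "tr (m - 1) (b * ptl_elem 1 2 * a) = tr (m - 1) (a * b * ptl_elem 1 2)"
        using tr_comm[OF m(2), of "b * ptl_elem 1 2" a] by (simp add: mult.assoc)
      also have "\<dots> = 0" using Suc base by simp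
      finally show ?thesis
        using tr_comm[OF m(1), of "a * g" "b * ptl_elem 1 2"] by (simp add: mult.assoc)
    qed
  next
    case (add x y)
    then show ?case using m by (simp add: distrib_right tr_add)
  next
    case (cong x y)
    then show ?case using tr_cong[of m "x * ptl_elem 1 2" "y * ptl_elem 1 2"] by (simp add: img_mult)
  qed
qed

text \<open>Inserting \<open>W * V = 1\<close> behind the relator and rotating \<open>V\<close> to
  the front lowers its indices by one. The cofactor becomes \<open>V * x * W\<close>, so
  \<open>x\<close> must be general in the induction.\<close>

lemma tr_ptl_elem_Suc_vanish:
  assumes z0: "(A + B) * (B + (1 + \<phi> u) * A) = 0"
  shows "1 \<le> i \<Longrightarrow> Suc i < m \<Longrightarrow> x \<in> F m \<Longrightarrow> tr m (x * ptl_elem i (Suc i)) = 0"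
proof (induction i arbitrary: x rule: nat_induct_at_least)
  case base
  then show ?case using tr_ptl_elem_vanish[OF z0, of m m x] by (simp add: numeral_2_eq_2)
next
  case (Suc i)
  define W where "W = Tf i * Tf (Suc i) * Tf (Suc (Suc i))"
  define V where "V = Tinv (Suc (Suc i)) * Tinv (Suc i) * Tinv i"
  have inv: "bt_img m (Tf j) * (bt_img m (Tinv j) * t) = bt_img m 1 * t" if "1 \<le> j" "j < m" for j t
    using img_Tinv(1)[OF that] by (metis mult.assoc img_mult)
  have one: "bt_img m a * (bt_img m 1 * t) = bt_img m a * t" for a t
    by (metis mult.assoc img_one(2))
  have WV: "bt_img m (W * V) = bt_img m 1"
    using Suc.hyps Suc.prems img_Tinv(1)[of i m]
    by (simp add: W_def V_def img_mult mult.assoc inv one)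
  have WF: "W \<in> F m" "V \<in> F m" using Suc by (simp_all add: W_def V_def)
  have m: "1 \<le> m" using Suc by simp
  let ?ptl_elem = "ptl_elem (Suc i) (Suc (Suc i))"
  have "tr m (x * ?ptl_elem) = tr m (x * ?ptl_elem * (W * V))"
    by (rule tr_cong) (simp only: img_mult[of m "x * ?ptl_elem"] WV img_one)
  also have "\<dots> = tr m (x * (?ptl_elem * W) * V)" by (simp add: mult.assoc)
  also have "\<dots> = tr m (x * (W * ptl_elem i (Suc i)) * V)"
    using img_ptl_elem_shift[of i m] Suc by (intro tr_cong) (simp add: img_mult[of m _ V] img_mult[of m x] W_def)
  also have "\<dots> = tr m (V * x * W * ptl_elem i (Suc i))"
    using tr_comm[OF m, of "x * (W * ptl_elem i (Suc i))" V] by (simp add: mult.assoc)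
  also have "\<dots> = 0" using Suc WF by simp
  finally show ?case .
qed

lemma tr_ptl_elem_adj_vanish:
  assumes z0: "(A + B) * (B + (1 + \<phi> u) * A) = 0"
    and ij: "1 \<le> i" "i < m" "1 \<le> j" "j < m" "adj i j" and x: "x \<in> F m"
  shows "tr m (x * ptl_elem i j) = 0"
proof -
  from ij(5) consider "j = Suc i" | "i = Suc j" by linarith
  then show ?thesis
  proof cases
    case 1
    then show ?thesis using tr_ptl_elem_Suc_vanish[OF z0] ij x by simp
  next
    case 2
    have "tr m (x * ptl_elem i j) = tr m (x * ptl_elem j i)"
      by (rule tr_cong) (simp add: img_mult[of m x] img_ptl_elem(1)[OF ij])
    then show ?thesis using tr_ptl_elem_Suc_vanish[OF z0] ij x 2 by simp
  qed
qed

section \<open>Factorisation through the quotient\<close>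

lemma PTL_ideal_vanish:
  assumes z0: "(A + B) * (B + (1 + \<phi> u) * A) = 0 \<or> m < 3" and m: "1 \<le> m"
    and f: "f \<in> rel_ideal m (PTL_rels m)"
  shows "tr m f = 0"
proof -
  \<comment> \<open>The largest two-sided ideal of \<open>F m\<close> on which the trace vanishes;
    it suffices to find the relators in it.\<close>
  define I where "I = {f \<in> F m. \<forall>x\<in>F m. \<forall>y\<in>F m. tr m (x * f * y) = 0}"
  have "rel_ideal m (PTL_rels m) \<subseteq> I"
  proof (rule rel_idealI)
    show "PTL_rels m \<subseteq> I"
    proof
      fix g assume g: "g \<in> PTL_rels m"
      have "tr m (x * g * y) = 0" if "x \<in> F m" "y \<in> F m" for x y
      proof (cases "g \<in> BT_rels m")
        case True
        then have "bt_img m g = bt_img m 0" using BT_rels_subset by (intro img_eqI) auto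
        then have "bt_img m (x * g * y) = bt_img m 0" by (simp add: img_mult)
        from tr_cong[OF this] show ?thesis using tr_zero[OF m] by simp
      next
        case False
        then obtain i j where ij: "1 \<le> i" "i < m" "1 \<le> j" "j < m" "adj i j" and gz: "g = ptl_elem i j"
          using g unfolding PTL_rels_def ptl_elem_def Let_def atLeastLessThan_iff by blast
        \<comment> \<open>Two adjacent indices between 1 and \<open>m - 1\<close> exist only from
          \<open>m = 3\<close> on.\<close>
        then have "\<not> m < 3" by linarith
        then have "tr m (y * x * ptl_elem i j) = 0"
          using z0 tr_ptl_elem_adj_vanish[OF _ ij] that by simp
        then show ?thesis using tr_comm[OF m, of "x * g" y] gz by (simp add: mult.assoc)
      qed
      then show "g \<in> I" using g PTL_rels_subset by (auto simp: I_def)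
    qed
    show "I \<subseteq> F m" by (auto simp: I_def)
    show "0 \<in> I" by (simp add: I_def tr_zero[OF m])
    show "f + g \<in> I" if "f \<in> I" "g \<in> I" for f g
      using that by (simp add: I_def distrib_left distrib_right tr_add[OF m])
    show "x * f \<in> I" if "f \<in> I" "x \<in> F m" for f x
      using that by (simp add: I_def flip: mult.assoc)
    show "f * x \<in> I" if "f \<in> I" "x \<in> F m" for f x
    proof -
      have "tr m (a * f * (x * b)) = 0" if "a \<in> F m" "b \<in> F m" for a b
        using that \<open>f \<in> I\<close> \<open>x \<in> F m\<close> by (simp add: I_def)
      then show ?thesis using that by (simp add: I_def mult.assoc)
    qed
  qed
  with f have "f \<in> I" by blast
  then have "tr m (1 * f * 1) = 0" unfolding I_def using F_one by blast
  then show ?thesis by simp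
qed

lemma passes_iff:
  assumes m: "1 \<le> m"
  shows "passes_to_PTL \<phi> A B m (\<rho> m) \<longleftrightarrow> (\<forall>f\<in>rel_ideal m (PTL_rels m). tr m f = 0)"
proof
  note P = PTL_rels_subset[of m]
  have proj: "PTL_proj m (bt_cls m f) = cls m (PTL_rels m) f" if "f \<in> F m" for f
    using that canon_cls[OF BT_rels_subset _ P order_refl that]
    by (simp add: PTL_proj_def bt_cls_F PTL_rels_def)
  {
    assume "passes_to_PTL \<phi> A B m (\<rho> m)"
    then obtain r' where lin: "linear_map \<phi> (PTL m) r'"
      and r': "\<And>x. x \<in> carrier (BT m) \<Longrightarrow> r' (PTL_proj m x) = \<rho> m x"
      by (auto simp: passes_to_PTL_def)
    show "\<forall>f\<in>rel_ideal m (PTL_rels m). tr m f = 0"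
    proof
      fix f assume f: "f \<in> rel_ideal m (PTL_rels m)"
      have fF: "f \<in> F m" using f additive_subgroup.a_subset[OF ideal.axioms(1)[OF rel_ideal_ideal[OF P]]] by blast
      have "tr m f = r' (cls m (PTL_rels m) f)"
        using r'[of "bt_cls m f"] proj[OF fF] by (simp add: tr_def)
      also have "cls m (PTL_rels m) f = cls m (PTL_rels m) 0"
        using f fF by (simp add: cls_eq_iff[OF P])
      also have "r' (cls m (PTL_rels m) 0) = tr m 0"
        using r'[of "bt_cls m 0"] proj[of 0] by (simp add: tr_def)
      finally show "tr m f = 0" using tr_zero[OF m] by simp
    qed
  }
  assume van: "\<forall>f\<in>rel_ideal m (PTL_rels m). tr m f = 0"
  \<comment> \<open>The value at an arbitrary representative; two representatives differ by an
    element of the ideal, where the trace is zero.\<close>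
  define r' where "r' X = tr m (SOME f. f \<in> F m \<and> X = cls m (PTL_rels m) f)" for X
  have r': "r' (cls m (PTL_rels m) f) = tr m f" if f: "f \<in> F m" for f
  proof -
    define g where "g = (SOME g. g \<in> F m \<and> cls m (PTL_rels m) f = cls m (PTL_rels m) g)"
    have "g \<in> F m \<and> cls m (PTL_rels m) f = cls m (PTL_rels m) g"
      unfolding g_def by (rule someI[of _ f]) (simp add: f)
    then have "tr m (f - g) = 0" using van cls_eq_iff[OF P f] by blast
    then have "tr m f = tr m g" using tr_add[OF m, of "f - g" g] by simp
    then show ?thesis by (simp add: r'_def g_def)
  qed
  have "r' (cls m (PTL_rels m) f \<oplus>\<^bsub>PTL m\<^esub> cls m (PTL_rels m) g)
      = r' (cls m (PTL_rels m) f) + r' (cls m (PTL_rels m) g)"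
    and "r' (c \<odot>\<^bsub>PTL m\<^esub> cls m (PTL_rels m) f) = \<phi> c * r' (cls m (PTL_rels m) f)"
    if "f \<in> F m" "g \<in> F m" for f g c
    using that by (simp_all add: PTL_def presented_ops[OF P that] presented_ops[OF P that(2,1)] r'
        tr_add[OF m] tr_scal[OF m])
  then have "linear_map \<phi> (PTL m) r'"
    unfolding linear_map_def PTL_def presented_sel by blast
  moreover have "r' \<in> carrier (PTL m) \<rightarrow> K_adjoin \<phi> A B"
    using r' tr_in_K_adjoin[OF m] by (auto simp: PTL_def presented_sel)
  moreover have "r' (PTL_proj m x) = \<rho> m x" if "x \<in> carrier (BT m)" for x
  proof -
    from that obtain f where f: "f \<in> F m" "x = bt_cls m f"
      by (auto simp: BT_def presented_sel bt_cls_F)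
    then show ?thesis using proj r' by (simp add: tr_def)
  qed
  ultimately show "passes_to_PTL \<phi> A B m (\<rho> m)"
    unfolding passes_to_PTL_def by blast
qed

lemma parameters_iff:
  "(A + B) * (B + (1 + \<phi> u) * A) = 0 \<longleftrightarrow> A = - B \<or> A = - B / (1 + \<phi> u)"
proof -
  have "1 + \<phi> u \<noteq> 0"
    using \<phi>(6)[OF u_nonzero(2)] by (simp add: \<phi>)
  then have "A = - B / (1 + \<phi> u) \<longleftrightarrow> A * (1 + \<phi> u) = - B"
    by (rule nonzero_eq_divide_eq)
  also have "\<dots> \<longleftrightarrow> B + (1 + \<phi> u) * A = 0"
    by (simp only: eq_neg_iff_add_eq_0 add.commute[of B] mult.commute[of A])
  finally have "A = - B / (1 + \<phi> u) \<longleftrightarrow> B + (1 + \<phi> u) * A = 0" .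
  then show ?thesis
    by (simp only: mult_eq_0_iff eq_neg_iff_add_eq_0)
qed

lemma passes_if: "1 \<le> m \<Longrightarrow> (A + B) * (B + (1 + \<phi> u) * A) = 0 \<Longrightarrow> passes_to_PTL \<phi> A B m (\<rho> m)"
  using PTL_ideal_vanish passes_iff by blast

lemma passes_only_if:
  assumes "3 \<le> m" "passes_to_PTL \<phi> A B m (\<rho> m)"
  shows "(A + B) * (B + (1 + \<phi> u) * A) = 0"
proof -
  have "Ef 1 * Ef 2 * T2f 1 2 \<in> PTL_rels m"
    using assms(1) unfolding PTL_rels_def Let_def by force
  then have "ptl_elem 1 2 \<in> rel_ideal m (PTL_rels m)"
    using rel_ideal_self[OF PTL_rels_subset] by (auto simp: ptl_elem_def)
  then show ?thesis using passes_iff[of m] assms tr_ptl_elem[of m] by auto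
qed

end

text \<open>For \<open>n < 3\<close> there are no adjacent indices and the trace passes for all
  parameters. Hence the equivalence for a single \<open>n\<close> is stated from 3 on, and from 1 on
  for all \<open>n\<close> together.\<close>

theorem theorem7p7:
  fixes \<phi> :: "K \<Rightarrow> 'l::field" and A B :: 'l and \<rho> :: "nat \<Rightarrow> free set \<Rightarrow> 'l"
  assumes "field_extension \<phi>"
    and "\<exists>!\<rho>'. markov_trace \<phi> A B \<rho>'"
    and "markov_trace \<phi> A B \<rho>"
  shows "(\<forall>n\<ge>3. passes_to_PTL \<phi> A B n (\<rho> n) \<longleftrightarrow> A = - B \<or> A = - B / (1 + \<phi> u)) \<and>
    ((\<forall>n\<ge>1. passes_to_PTL \<phi> A B n (\<rho> n)) \<longleftrightarrow> A = - B \<or> A = - B / (1 + \<phi> u))"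
proof -
  interpret markov \<phi> A B \<rho> using assms by unfold_locales
  have "passes_to_PTL \<phi> A B n (\<rho> n) \<longleftrightarrow> A = - B \<or> A = - B / (1 + \<phi> u)" if "3 \<le> n" for n
    using that passes_if[of n] passes_only_if[of n] parameters_iff by auto
  moreover have "passes_to_PTL \<phi> A B n (\<rho> n)" if "1 \<le> n" "A = - B \<or> A = - B / (1 + \<phi> u)" for n
    using that passes_if parameters_iff by blast
  moreover have "passes_to_PTL \<phi> A B 3 (\<rho> 3)" if "\<forall>n\<ge>1. passes_to_PTL \<phi> A B n (\<rho> n)"
    using that by simp
  ultimately show ?thesis by blast
qed

end
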